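(* Let $1\le p,q<\infty$. Assume that $\Phi=(\phi_1,\dots,\phi_r)^T\in W_0(L^{1,1})^{(r)}$ has compact support (each $\phi_i$ has compact support) and that $P$ is a bounded projection from $L^{p,q}(\mathbb{R}^{d+1})$ onto $V_{p,q}(\Phi)$. Let $\psi\in W_0(L^{1,1})$ with $\int_{\mathbb{R}^{d+1}}\psi=1$. Then there are a density $\gamma_0=\gamma_0(\Phi,\psi)>0$ and $a_0=a_0(\Phi,\psi)>0$ such that for every $\gamma\le\gamma_0$, every $\gamma$-dense set $X=\{(x_j,y_k):j,k\in\mathbb{J}\}$ in $\mathbb{R}^{d+1}$, and every $0<a\le a_0$, any $f\in V_{p,q}(\Phi)$ can be reconstructed from its average samples $\{\langle f,\psi_a(\cdot-x_j,\cdot-y_k)\rangle: j,k\in\mathbb{J}\}$ by the iterative algorithm $$f_1=PA_{X,a}f,\qquad f_{n+1}=PA_{X,a}(f-f_n)+f_n\quad (n\ge 1).$$ That is, the iterate $f_n$ converges to $f$ in the $L^{p,q}$ norm. Furthermore, the convergence is geometric: $$\|f-f_n\|_{L^{p,q}}\le M\alpha^n\quad\text{for all } n\ge 1,$$ for some $\alpha=\alpha(\gamma,a,P,\Phi,\psi)<1$ and some $M<\infty$.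
   Context: Points of $\mathbb{R}^{d+1}$ are written $(x,y)\in\mathbb{R}\times\mathbb{R}^d$. For $1\le p,q<\infty$, $L^{p,q}=L^{p,q}(\mathbb{R}^{d+1})$ is the space of measurable functions $f$ with $$\|f\|_{L^{p,q}}=\Big[\int_{\mathbb{R}}\Big(\int_{\mathbb{R}^d}|f(x,y)|^q\,dy\Big)^{p/q}dx\Big]^{1/p}<\infty,$$ and $\ell^{p,q}=\ell^{p,q}(\mathbb{Z}^{d+1})$ is the space of sequences $c$ with $\|c\|_{\ell^{p,q}}^p=\sum_{k_1\in\mathbb{Z}}\big(\sum_{k_2\in\mathbb{Z}^d}|c(k_1,k_2)|^q\big)^{p/q}<\infty$. The mixed Wiener amalgam space $W(L^{p,q})$ consists of measurable $f$ with $$\|f\|_{W(L^{p,q})}^p=\sum_{n\in\mathbb{Z}}\sup_{x\in[0,1]}\Big[\sum_{l\in\mathbb{Z}^d}\sup_{y\in[0,1]^d}|f(x+n,y+l)|^q\Big]^{p/q}<\infty,$$ and $W_0(L^{p,q})$ is the space of all continuous functions in $W(L^{p,q})$. $(B)^{(r)}$ denotes the product of $r$ copies of a Banach space $B$. For $\Phi=(\phi_1,\dots,\phi_r)^T\in W(L^{1,1})^{(r)}$, the multiply generated shift-invariant space is $$V_{p,q}(\Phi)=\Big\{\sum_{i=1}^r\sum_{k_1\in\mathbb{Z}}\sum_{k_2\in\mathbb{Z}^d}c_i(k_1,k_2)\phi_i(\cdot-k_1,\cdot-k_2): c_i\in\ell^{p,q},\ 1\le i\le r\Big\}.$$ $\mathbb{J}$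 is a countable index set. $B_\gamma(x,y)$ is the open ball with center $(x,y)$ and radius $\gamma$. A set $X=\{(x_j,y_k):j,k\in\mathbb{J}\}$, $x_j\in\mathbb{R}$, $y_k\in\mathbb{R}^d$, is $\gamma_0$-dense in $\mathbb{R}^{d+1}$ if $\mathbb{R}^{d+1}=\bigcup_{j,k}B_\gamma(x_j,y_k)$ for every $\gamma>\gamma_0$. A bounded uniform partition of unity associated to $\{B_\gamma(x_j,y_k):j,k\in\mathbb{J}\}$ is a set of functions $\{\beta_{j,k}:j,k\in\mathbb{J}\}$ with $0\le\beta_{j,k}\le1$, $\operatorname{supp}\beta_{j,k}\subset B_\gamma(x_j,y_k)$, and $\sum_{j\in\mathbb{J}}\sum_{k\in\mathbb{J}}\beta_{j,k}=1$. Put $\langle f,g\rangle=\int_{\mathbb{R}^{d+1}}f\,\overline{g}$ and $\psi_a(\cdot)=a^{-(d+1)}\psi(\cdot/a)$. Given a $\gamma$-dense set $X$ and a bounded uniform partition of unity $\{\beta_{j,k}\}$ associated to $\{B_\gamma(x_j,y_k)\}$, define $$A_{X,a}f=\sum_{j\in\mathbb{J}}\sum_{k\in\mathbb{J}}\langle f,\psi_a(\cdot-x_j,\cdot-y_k)\rangle\,\beta_{j,k}.$$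
   Formalization: The density γ_0 and the bound a_0 are allowed to depend on the projection P (and on p, q), not only on Φ and ψ; independence of P is false, since projections onto V_{p,q}(Φ) of large norm make the iteration diverge. *)

theory Defs
  imports "HOL-Analysis.Analysis"
begin

text \<open>
  Points of \<open>\<real>\<^bsup>d+1\<^esup> = \<real> \<times> \<real>\<^bsup>d\<^esup>\<close> are pairs, with \<open>d = CARD('n)\<close>; the product metric of the
  library is the Euclidean one. All functions are complex valued, and ``measurable'' means
  Lebesgue measurable.
\<close>

type_synonym 'n point = "real \<times> (real ^ 'n)"
type_synonym 'n index = "int \<times> (int ^ 'n)"


section \<open>Mixed-norm spaces\<close>

text \<open>Real powers on \<open>[0,\<infinity>]\<close>; only used with a positive exponent, whence \<open>\<infinity>\<close> is sent to \<open>\<infinity>\<close>.\<close>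

definition epowr :: "ennreal \<Rightarrow> real \<Rightarrow> ennreal" (infixr "epowr" 80) where
  "t epowr s = (if t = \<infinity> then \<infinity> else ennreal (enn2real t powr s))"

text \<open>The norms take values in \<open>[0,\<infinity>]\<close>, and membership in a space is finiteness of the norm.
  Elements of \<open>L\<^bsup>p,q\<^esup>\<close> are represented by functions, so equality in \<open>L\<^bsup>p,q\<^esup>\<close> is equality almost
  everywhere.\<close>

definition Lpq_norm :: "real \<Rightarrow> real \<Rightarrow> ('n::finite point \<Rightarrow> complex) \<Rightarrow> ennreal" where
  "Lpq_norm p q f =
     (\<integral>\<^sup>+ x. (\<integral>\<^sup>+ y. ennreal (cmod (f (x, y))) epowr q \<partial>lebesgue) epowr (p / q) \<partial>lebesgue)
       epowr (1 / p)"

definition Lpq :: "real \<Rightarrow> real \<Rightarrow> ('n::finite point \<Rightarrow> complex) set" where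
  "Lpq p q = {f \<in> borel_measurable lebesgue. Lpq_norm p q f < \<infinity>}"

definition lpq_norm :: "real \<Rightarrow> real \<Rightarrow> ('n::finite index \<Rightarrow> complex) \<Rightarrow> ennreal" where
  "lpq_norm p q c =
     (\<Sum>\<^sub>\<infinity>k1\<in>UNIV. (\<Sum>\<^sub>\<infinity>k2\<in>UNIV. ennreal (cmod (c (k1, k2))) epowr q) epowr (p / q))
       epowr (1 / p)"

definition lpq :: "real \<Rightarrow> real \<Rightarrow> ('n::finite index \<Rightarrow> complex) set" where
  "lpq p q = {c. lpq_norm p q c < \<infinity>}"


section \<open>Wiener amalgam spaces\<close>

definition of_int_vec :: "int ^ 'n \<Rightarrow> real ^ 'n::finite" where
  "of_int_vec l = (\<chi> i. real_of_int (l $ i))"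

definition W_norm :: "real \<Rightarrow> real \<Rightarrow> ('n::finite point \<Rightarrow> complex) \<Rightarrow> ennreal" where
  "W_norm p q f =
     (\<Sum>\<^sub>\<infinity>n\<in>UNIV. SUP x\<in>{0..1}.
        (\<Sum>\<^sub>\<infinity>l\<in>UNIV. SUP y\<in>cbox 0 1.
           ennreal (cmod (f (x + real_of_int n, y + of_int_vec l))) epowr q) epowr (p / q))
       epowr (1 / p)"

definition W :: "real \<Rightarrow> real \<Rightarrow> ('n::finite point \<Rightarrow> complex) set" where
  "W p q = {f \<in> borel_measurable lebesgue. W_norm p q f < \<infinity>}"

definition W0 :: "real \<Rightarrow> real \<Rightarrow> ('n::finite point \<Rightarrow> complex) set" where
  "W0 p q = {f \<in> W p q. continuous_on UNIV f}"

definition supp :: "('a::topological_space \<Rightarrow> 'b::zero) \<Rightarrow> 'a set" where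
  "supp f = closure {z. f z \<noteq> 0}"


section \<open>Shift-invariant spaces and projections\<close>

text \<open>The generators are \<open>\<Phi> 1, \<dots>, \<Phi> r\<close>. For generators in \<open>W(L\<^bsup>1,1\<^esup>)\<close> and coefficients in
  \<open>\<ell>\<^bsup>p,q\<^esup>\<close> the double series converges absolutely at every point, so it is written as one
  unordered sum over all \<open>(k\<^sub>1,k\<^sub>2)\<close>.\<close>

definition shift_comb ::
  "nat \<Rightarrow> (nat \<Rightarrow> 'n::finite point \<Rightarrow> complex) \<Rightarrow> (nat \<Rightarrow> 'n index \<Rightarrow> complex) \<Rightarrow> 'n point \<Rightarrow> complex"
where
  "shift_comb r \<Phi> c = (\<lambda>(x, y).
     \<Sum>i=1..r. \<Sum>\<^sub>\<infinity>(k1, k2)\<in>UNIV. c i (k1, k2) * \<Phi> i (x - real_of_int k1, y - of_int_vec k2))"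

definition V ::
  "real \<Rightarrow> real \<Rightarrow> nat \<Rightarrow> (nat \<Rightarrow> 'n::finite point \<Rightarrow> complex) \<Rightarrow> ('n point \<Rightarrow> complex) set" where
  "V p q r \<Phi> = {shift_comb r \<Phi> c | c. \<forall>i\<in>{1..r}. c i \<in> lpq p q}"

text \<open>\<open>P\<close> acts on representatives, and only its values on \<open>L\<^bsup>p,q\<^esup>\<close> matter. Linearity and
  boundedness make it compatible with equality almost everywhere.
  The last three conditions say \<open>P \<circ> P = P\<close> and that the range of \<open>P\<close> is \<open>U\<close>.\<close>

definition bounded_projection_onto ::
  "real \<Rightarrow> real \<Rightarrow> ('n::finite point \<Rightarrow> complex) set
     \<Rightarrow> (('n point \<Rightarrow> complex) \<Rightarrow> ('n point \<Rightarrow> complex)) \<Rightarrow> bool" where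
  "bounded_projection_onto p q U P \<longleftrightarrow>
     (\<forall>f\<in>Lpq p q. P f \<in> Lpq p q) \<and>
     (\<forall>f\<in>Lpq p q. \<forall>g\<in>Lpq p q. AE z in lebesgue. P (\<lambda>w. f w + g w) z = P f z + P g z) \<and>
     (\<forall>f\<in>Lpq p q. \<forall>t. AE z in lebesgue. P (\<lambda>w. t * f w) z = t * P f z) \<and>
     (\<exists>C::real. \<forall>f\<in>Lpq p q. Lpq_norm p q (P f) \<le> ennreal C * Lpq_norm p q f) \<and>
     (\<forall>f\<in>Lpq p q. AE z in lebesgue. P (P f) z = P f z) \<and>
     (\<forall>f\<in>Lpq p q. \<exists>g\<in>U. AE z in lebesgue. P f z = g z) \<and>
     (\<forall>g\<in>U. \<exists>f\<in>Lpq p q. AE z in lebesgue. P f z = g z)"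


section \<open>Sampling sets and average samples\<close>

definition dense_grid ::
  "real \<Rightarrow> 'j set \<Rightarrow> ('j \<Rightarrow> real) \<Rightarrow> ('j \<Rightarrow> real ^ 'n::finite) \<Rightarrow> bool" where
  "dense_grid \<gamma>0 J x y \<longleftrightarrow> (\<forall>\<gamma>>\<gamma>0. (\<Union>j\<in>J. \<Union>k\<in>J. ball (x j, y k) \<gamma>) = UNIV)"

text \<open>Measurability of the \<open>\<beta> j k\<close> is implicit in applying an operator on \<open>L\<^bsup>p,q\<^esup>\<close> to series in
  them. Requiring \<open>has_sum\<close> over \<open>J \<times> J\<close> rules out the default value of a divergent sum.\<close>

definition bupu ::
  "real \<Rightarrow> 'j set \<Rightarrow> ('j \<Rightarrow> real) \<Rightarrow> ('j \<Rightarrow> real ^ 'n::finite)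
     \<Rightarrow> ('j \<Rightarrow> 'j \<Rightarrow> 'n point \<Rightarrow> real) \<Rightarrow> bool" where
  "bupu \<gamma> J x y \<beta> \<longleftrightarrow>
     (\<forall>j\<in>J. \<forall>k\<in>J. \<beta> j k \<in> borel_measurable lebesgue \<and>
        (\<forall>z. 0 \<le> \<beta> j k z \<and> \<beta> j k z \<le> 1) \<and> supp (\<beta> j k) \<subseteq> ball (x j, y k) \<gamma>) \<and>
     (\<forall>z. ((\<lambda>(j, k). \<beta> j k z) has_sum 1) (J \<times> J))"

definition pairing :: "('n::finite point \<Rightarrow> complex) \<Rightarrow> ('n point \<Rightarrow> complex) \<Rightarrow> complex" where
  "pairing f g = (LINT z|lebesgue. f z * cnj (g z))"

definition dilate :: "real \<Rightarrow> ('n::finite point \<Rightarrow> complex) \<Rightarrow> 'n point \<Rightarrow> complex" where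
  "dilate a \<psi> z = (1 / a ^ (CARD('n) + 1)) *\<^sub>R \<psi> ((1 / a) *\<^sub>R z)"

definition avg_sample ::
  "('n::finite point \<Rightarrow> complex) \<Rightarrow> real \<Rightarrow> ('n point \<Rightarrow> complex) \<Rightarrow> 'n point \<Rightarrow> complex" where
  "avg_sample \<psi> a f w = pairing f (\<lambda>z. dilate a \<psi> (z - w))"

text \<open>For \<open>f \<in> L\<^bsup>p,q\<^esup>\<close> and \<open>\<psi> \<in> W\<^sub>0(L\<^bsup>1,1\<^esup>)\<close> the average samples are bounded, so for a bounded
  uniform partition of unity the double series converges absolutely at every point.\<close>

definition avg_op ::
  "('n::finite point \<Rightarrow> complex) \<Rightarrow> real \<Rightarrow> 'j set \<Rightarrow> ('j \<Rightarrow> real) \<Rightarrow> ('j \<Rightarrow> real ^ 'n)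
     \<Rightarrow> ('j \<Rightarrow> 'j \<Rightarrow> 'n point \<Rightarrow> real) \<Rightarrow> ('n point \<Rightarrow> complex) \<Rightarrow> 'n point \<Rightarrow> complex" where
  "avg_op \<psi> a J x y \<beta> f z =
     (\<Sum>\<^sub>\<infinity>(j, k)\<in>J \<times> J. avg_sample \<psi> a f (x j, y k) * complex_of_real (\<beta> j k z))"

end

theory Submission
  imports Defs
begin

text \<open>
  Let \<open>A\<close> be the sampling operator. Everything rests on the estimate
  \<open>\<parallel>f - A f\<parallel> \<le> \<kappa> \<parallel>f\<parallel>\<close> for \<open>f \<in> V\<close>, with \<open>\<kappa>\<close> as small as desired once \<open>\<gamma>\<close> and \<open>a\<close> are small
  (\<open>averaging_near_identity\<close>). Given it, the error \<open>e\<^sub>n = f - f\<^sub>n\<close> agrees almost everywhere with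
  an element of \<open>V\<close>, so \<open>P\<close> fixes it and \<open>e\<^bsub>n+1\<^esub> = e\<^sub>n - P A e\<^sub>n = P (e\<^sub>n - A e\<^sub>n)\<close> again lies in the range
  of \<open>P\<close>. Hence \<open>\<parallel>e\<^bsub>n+1\<^esub>\<parallel> \<le> C \<kappa> \<parallel>e\<^sub>n\<parallel>\<close>, where \<open>C\<close> bounds \<open>P\<close>, and \<open>\<kappa> = 1 / (2 C)\<close> makes every step
  halve the error (\<open>projection_step_contracts\<close>).

  The estimate is local. The generators have compact support, so on a ball of fixed radius,
  translated by a lattice point, the elements of \<open>V\<close> run through one fixed finite-dimensional
  space of continuous functions. There all norms are equivalent: the coefficients of a function
  in a suitable spanning set are bounded by its \<open>L\<^sup>1\<close> norm on the ball
  (\<open>span_coefficient_bound\<close>). Consequently both the size and the oscillation of \<open>f \<in> V\<close> near a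
  point \<open>z\<close> are bounded by the integral \<open>G z\<close> of \<open>\<bar>f\<bar>\<close> over a ball around \<open>z\<close>, with a factor that
  tends to 0 with the scale in the case of the oscillation (\<open>shift_comb_local_estimates\<close>).

  A sample is \<open>\<integral> f (w + a u) cnj (\<psi> u) du\<close>, and \<open>\<psi>\<close> has integral 1. So \<open>f z - A f z\<close> is controlled by the
  integral of \<open>\<bar>f z - f (w + a u)\<bar> \<bar>\<psi> u\<bar>\<close> with \<open>w\<close> near \<open>z\<close>. For \<open>\<bar>u\<bar> \<le> R\<close> the oscillation estimate
  applies, and for \<open>\<bar>u\<bar> > R\<close> the size estimate leaves averages of \<open>G z\<close> and \<open>G (z + a u)\<close> against the tail
  of \<open>\<psi>\<close>. All these bounds are averages of translates of \<open>\<bar>f\<bar>\<close>. Since the mixed norm is invariant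
  under translations, Minkowski's integral inequality, applied once in each group of variables,
  bounds the norm of such an average by the total weight times the norm of \<open>f\<close>
  (\<open>mixed_norm_average_of_translates\<close>).
\<close>

section \<open>Real powers on the extended half-line\<close>

lemma epowr_ennreal: "0 \<le> t \<Longrightarrow> ennreal t epowr s = ennreal (t powr s)"
  by (simp add: epowr_def)

lemma epowr_top [simp]: "top epowr s = top"
  by (simp add: epowr_def)

lemma epowr_0 [simp]: "0 epowr s = 0"
  by (simp add: epowr_def)

lemma epowr_1_left [simp]: "1 epowr s = 1"
  by (simp add: epowr_def)

lemma epowr_1_right [simp]: "t epowr 1 = t"
  by (cases t) (simp_all add: epowr_ennreal)

lemma epowr_eq_0_iff [simp]: "t epowr s = 0 \<longleftrightarrow> t = 0"
  by (cases t) (auto simp: epowr_ennreal)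

lemma epowr_mono: "0 < s \<Longrightarrow> t \<le> u \<Longrightarrow> t epowr s \<le> u epowr s"
  by (cases t; cases u) (auto simp: epowr_ennreal top_unique intro!: ennreal_leI powr_mono2)

lemma epowr_mult: "0 < s \<Longrightarrow> (t * u) epowr s = t epowr s * u epowr s"
  by (cases t; cases u)
     (auto simp: epowr_ennreal powr_mult ennreal_mult_top ennreal_top_mult simp flip: ennreal_mult)

lemma epowr_epowr: "(t epowr s) epowr u = t epowr (s * u)"
  by (cases t) (auto simp: epowr_ennreal powr_powr)

lemma epowr_root_power [simp]: "0 < s \<Longrightarrow> (t epowr (1 / s)) epowr s = t"
  by (simp add: epowr_epowr)

lemma epowr_power_root [simp]: "0 < s \<Longrightarrow> (t epowr s) epowr (1 / s) = t"
  by (simp add: epowr_epowr)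

lemma measurable_epowr [measurable]:
  assumes [measurable]: "f \<in> borel_measurable M"
  shows "(\<lambda>x. f x epowr s) \<in> borel_measurable M"
proof -
  have [measurable]: "{x \<in> space M. f x = \<infinity>} \<in> sets M"
    using measurable_sets[OF assms, of "{\<infinity>}"] by (simp add: vimage_def Int_def conj_commute)
  show ?thesis unfolding epowr_def by simp
qed

section \<open>Lebesgue norms and the integral Minkowski inequality\<close>

definition Lnorm :: "'a measure \<Rightarrow> real \<Rightarrow> ('a \<Rightarrow> ennreal) \<Rightarrow> ennreal" where
  "Lnorm M q f = (\<integral>\<^sup>+ x. f x epowr q \<partial>M) epowr (1 / q)"

lemma Lnorm_mono_AE:
  assumes "0 < q" "AE x in M. f x \<le> g x"
  shows "Lnorm M q f \<le> Lnorm M q g"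
  using assms unfolding Lnorm_def by (intro epowr_mono nn_integral_mono_AE) (auto simp: epowr_mono)

lemma Lnorm_cong_AE: "AE x in M. f x = g x \<Longrightarrow> Lnorm M q f = Lnorm M q g"
  unfolding Lnorm_def by (subst nn_integral_cong_AE[of _ "\<lambda>x. g x epowr q"]) auto

lemma Lnorm_cmult:
  assumes "0 < q" "f \<in> borel_measurable M"
  shows "Lnorm M q (\<lambda>x. c * f x) = c * Lnorm M q f"
  using assms by (simp add: Lnorm_def epowr_mult nn_integral_cmult)

lemma Lnorm_eq_0D:
  assumes "0 < q" "f \<in> borel_measurable M" "Lnorm M q f = 0"
  shows "AE x in M. f x = 0"
  using assms by (simp add: Lnorm_def nn_integral_0_iff_AE)

text \<open>The graph of \<open>t \<mapsto> t\<^sup>q\<close> lies above its tangent at 1. As \<open>\<infinity>\<close> is included,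
  integrating this inequality also settles divergent integrals.\<close>

lemma tangent_line_epowr:
  assumes "1 \<le> q"
  shows "ennreal q * t \<le> t epowr q + ennreal (q - 1)"
proof (cases t)
  case (real u)
  have "q * u \<le> u powr q + (q - 1)"
  proof (cases "u = 0")
    case False
    hence u: "u > 0" using real by simp
    have "(u powr q) powr (1/q) * 1 powr ((q-1)/q) \<le> (1/q) * u powr q + ((q-1)/q) * 1"
      using assms u by (intro Youngs_inequality_0) (auto simp: field_simps)
    hence "u \<le> (u powr q + (q - 1)) / q"
      using assms u by (simp add: powr_powr add_divide_distrib)
    thus ?thesis using assms by (simp add: field_simps)
  qed (use assms in auto)
  thus ?thesis using real assms
    by (simp add: epowr_ennreal flip: ennreal_mult ennreal_plus)
qed simp


text \<open>Jensen's inequality. Integrating the tangent line inequality for \<open>c * g\<close> with \<open>c\<close> the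
  reciprocal of the mean gives the claim when the mean is positive and finite; an infinite
  mean is handled by \<open>c = 1\<close>.\<close>

lemma nn_integral_epowr_le:
  assumes [measurable]: "g \<in> borel_measurable M" and M: "emeasure M (space M) = 1" and q: "1 \<le> q"
  shows "(\<integral>\<^sup>+ x. g x \<partial>M) epowr q \<le> (\<integral>\<^sup>+ x. g x epowr q \<partial>M)"
proof -
  define h where "h = (\<integral>\<^sup>+ x. g x \<partial>M)"
  have tangent: "ennreal q * (c * h) \<le> c epowr q * (\<integral>\<^sup>+ x. g x epowr q \<partial>M) + ennreal (q - 1)" for c
  proof -
    have "ennreal q * (c * h) = (\<integral>\<^sup>+ x. ennreal q * (c * g x) \<partial>M)"
      by (simp add: h_def nn_integral_cmult)
    also have "\<dots> \<le> (\<integral>\<^sup>+ x. c epowr q * g x epowr q + ennreal (q - 1) \<partial>M)"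
      using q by (intro nn_integral_mono) (simp add: tangent_line_epowr flip: epowr_mult)
    also have "\<dots> = c epowr q * (\<integral>\<^sup>+ x. g x epowr q \<partial>M) + ennreal (q - 1)"
      by (simp add: nn_integral_add nn_integral_cmult M)
    finally show ?thesis .
  qed
  show ?thesis
  proof (cases "h = 0 \<or> h = top")
    case True
    then show ?thesis
    proof
      assume "h = top"
      with tangent[of 1] q have "(\<integral>\<^sup>+ x. g x epowr q \<partial>M) = top"
        by (auto simp: ennreal_mult_top top_unique)
      thus ?thesis by simp
    qed (use q in \<open>simp add: h_def[symmetric]\<close>)
  next
    case False
    define I where "I = (\<integral>\<^sup>+ x. g x epowr q \<partial>M)"
    have hh: "inverse h * h = 1"
      using False ennreal_divide_self[of h] by (simp add: divide_ennreal_def mult.commute less_top)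
    have "ennreal q \<le> inverse h epowr q * I + ennreal (q - 1)"
      using tangent[of "inverse h"] by (simp add: hh I_def)
    hence "ennreal (q - 1) + 1 \<le> ennreal (q - 1) + inverse h epowr q * I"
      using q by (simp add: add.commute flip: ennreal_1 ennreal_plus)
    hence "1 \<le> inverse h epowr q * I"
      by (simp add: ennreal_add_left_cancel_le)
    hence "h epowr q * 1 \<le> h epowr q * (inverse h epowr q * I)"
      by (intro mult_left_mono) auto
    also have "\<dots> = (inverse h * h) epowr q * I"
      by (subst epowr_mult) (use q in \<open>auto simp: mult_ac\<close>)
    finally show ?thesis by (simp add: hh flip: h_def I_def)
  qed
qed

text \<open>For a mixed norm the outer exponent \<open>p / q\<close> may be less than 1, so Jensen's inequality with
  the given weight on \<open>M2\<close> is of no use; the weight has to depend on \<open>F\<close>. Let \<open>N v\<close> be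
  the norm of the slice \<open>\<lambda>x. F x v\<close> and \<open>D\<close> the integral of \<open>N\<close>. Under the probability measure with
  density \<open>N / D\<close> the inner integral is \<open>D\<close> times the mean of the normalised slices \<open>F x v / N v\<close>,
  and Jensen's inequality and Fubini's theorem reduce the claim to the fact that each of these
  slices has norm at most 1.\<close>

lemma (in pair_sigma_finite) Minkowski_integral_inequality:
  assumes F [measurable]: "case_prod F \<in> borel_measurable (M1 \<Otimes>\<^sub>M M2)" and q: "1 \<le> q"
  shows "Lnorm M1 q (\<lambda>x. \<integral>\<^sup>+ v. F x v \<partial>M2) \<le> (\<integral>\<^sup>+ v. Lnorm M1 q (\<lambda>x. F x v) \<partial>M2)"
proof -
  have q0: "0 < q" using q by simp
  define N where "N v = Lnorm M1 q (\<lambda>x. F x v)" for v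
  define D where "D = (\<integral>\<^sup>+ v. N v \<partial>M2)"
  have [measurable]: "N \<in> borel_measurable M2"
    unfolding N_def Lnorm_def by measurable
  \<comment> \<open>The division \<open>F x v / N v\<close> is harmless where \<open>N\<close> vanishes, since \<open>F\<close> vanishes there too.\<close>
  have null: "AE x in M1. AE v in M2. N v = 0 \<longrightarrow> F x v = 0"
  proof (rule AE_commute[THEN iffD2])
    have "N v = 0 \<longrightarrow> (AE x in M1. F x v = 0)" if "v \<in> space M2" for v
      using Lnorm_eq_0D[OF q0, of "\<lambda>x. F x v"] that unfolding N_def by auto
    hence "AE x in M1. N v = 0 \<longrightarrow> F x v = 0" if "v \<in> space M2" for v
      using that by (cases "N v = 0") auto
    thus "AE v in M2. AE x in M1. N v = 0 \<longrightarrow> F x v = 0"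
      by (rule AE_I2)
  qed measurable
  consider "D = top" | "D = 0" | "D \<noteq> 0" "D \<noteq> top" by blast
  thus ?thesis
  proof cases
    case 2
    hence "AE v in M2. N v = 0" by (simp add: D_def nn_integral_0_iff_AE)
    from null have "AE x in M1. (\<integral>\<^sup>+ v. F x v \<partial>M2) = 0"
    proof eventually_elim
      case (elim x)
      from elim \<open>AE v in M2. N v = 0\<close> have "AE v in M2. F x v = 0"
        by eventually_elim simp
      hence "(\<integral>\<^sup>+ v. F x v \<partial>M2) = (\<integral>\<^sup>+ v. 0 \<partial>M2)"
        by (rule nn_integral_cong_AE)
      thus ?case by simp
    qed
    hence "Lnorm M1 q (\<lambda>x. \<integral>\<^sup>+ v. F x v \<partial>M2) = Lnorm M1 q (\<lambda>x. 0)" by (rule Lnorm_cong_AE)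
    thus ?thesis using q by (simp add: Lnorm_def)
  next
    case 3
    define \<mu> where "\<mu> = density M2 (\<lambda>v. N v / D)"
    have mass: "emeasure \<mu> (space \<mu>) = 1"
    proof -
      have "emeasure \<mu> (space \<mu>) = (\<integral>\<^sup>+ v. N v / D \<partial>M2)"
        by (simp add: \<mu>_def emeasure_density)
      also have "\<dots> = D / D" by (simp add: nn_integral_divide D_def)
      finally show ?thesis using 3 by (simp add: less_top)
    qed
    have finN: "AE v in M2. N v \<noteq> top"
      using nn_integral_PInf_AE[of N M2] 3 by (simp add: D_def)
    have pt: "AE x in M1. (\<integral>\<^sup>+ v. F x v \<partial>M2) epowr q
                \<le> D epowr q * (\<integral>\<^sup>+ v. (F x v / N v) epowr q * (N v / D) \<partial>M2)"
      using null AE_space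
    proof eventually_elim
      case (elim x)
      note [measurable] = elim(2)
      have "(\<integral>\<^sup>+ v. F x v \<partial>M2) = (\<integral>\<^sup>+ v. D * (F x v / N v * (N v / D)) \<partial>M2)"
      proof (intro nn_integral_cong_AE)
        show "AE v in M2. F x v = D * (F x v / N v * (N v / D))"
          using elim(1) finN
        proof eventually_elim
          case (elim v)
          have "D * (F x v / N v * (N v / D)) = (D / D) * (F x v / N v * N v)"
            by (simp add: divide_ennreal_def mult_ac)
          also have "\<dots> = F x v"
          proof (cases "N v = 0")
            case False
            with elim have "F x v / N v * N v = F x v * (N v / N v)" "N v / N v = 1"
              by (auto simp: divide_ennreal_def mult_ac less_top intro!: ennreal_divide_self[unfolded divide_ennreal_def])
            moreover have "D / D = 1" using 3 by (simp add: less_top)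
            ultimately show ?thesis by simp
          qed (use elim in simp)
          finally show ?case by simp
        qed
      qed
      also have "\<dots> = D * (\<integral>\<^sup>+ v. F x v / N v * (N v / D) \<partial>M2)"
        by (simp add: nn_integral_cmult)
      also have "(\<integral>\<^sup>+ v. F x v / N v * (N v / D) \<partial>M2) = (\<integral>\<^sup>+ v. F x v / N v \<partial>\<mu>)"
        by (simp add: \<mu>_def nn_integral_density mult.commute)
      finally have "(\<integral>\<^sup>+ v. F x v \<partial>M2) epowr q = D epowr q * (\<integral>\<^sup>+ v. F x v / N v \<partial>\<mu>) epowr q"
        using q0 by (simp add: epowr_mult)
      also have "\<dots> \<le> D epowr q * (\<integral>\<^sup>+ v. (F x v / N v) epowr q \<partial>\<mu>)"
        using mass q by (intro mult_left_mono nn_integral_epowr_le) (auto simp: \<mu>_def)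
      also have "(\<integral>\<^sup>+ v. (F x v / N v) epowr q \<partial>\<mu>)
                   = (\<integral>\<^sup>+ v. (F x v / N v) epowr q * (N v / D) \<partial>M2)"
        by (simp add: \<mu>_def nn_integral_density mult.commute)
      finally show ?case .
    qed
    have unit: "(\<integral>\<^sup>+ x. (F x v / N v) epowr q * (N v / D) \<partial>M1) \<le> N v / D" if [measurable]: "v \<in> space M2" for v
    proof -
      have "(\<integral>\<^sup>+ x. (F x v / N v) epowr q \<partial>M1) = (\<integral>\<^sup>+ x. F x v epowr q \<partial>M1) * inverse (N v) epowr q"
        using q0 by (simp add: divide_ennreal_def epowr_mult nn_integral_multc)
      also have "(\<integral>\<^sup>+ x. F x v epowr q \<partial>M1) = N v epowr q"
        using q0 by (simp add: N_def Lnorm_def)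
      also have "N v epowr q * inverse (N v) epowr q = (N v / N v) epowr q"
        using q0 by (simp add: divide_ennreal_def epowr_mult)
      also have "\<dots> \<le> 1"
        by (cases "N v = 0 \<or> N v = top") (auto simp: ennreal_divide_self less_top)
      finally have "(\<integral>\<^sup>+ x. (F x v / N v) epowr q \<partial>M1) \<le> 1" .
      hence "(\<integral>\<^sup>+ x. (F x v / N v) epowr q \<partial>M1) * (N v / D) \<le> 1 * (N v / D)"
        by (intro mult_right_mono) auto
      thus ?thesis by (simp add: nn_integral_multc)
    qed
    have "(\<integral>\<^sup>+ x. (\<integral>\<^sup>+ v. F x v \<partial>M2) epowr q \<partial>M1)
        \<le> (\<integral>\<^sup>+ x. D epowr q * (\<integral>\<^sup>+ v. (F x v / N v) epowr q * (N v / D) \<partial>M2) \<partial>M1)"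
      by (rule nn_integral_mono_AE[OF pt])
    also have "\<dots> = D epowr q * (\<integral>\<^sup>+ v. (\<integral>\<^sup>+ x. (F x v / N v) epowr q * (N v / D) \<partial>M1) \<partial>M2)"
      by (simp add: nn_integral_cmult Fubini'[of "\<lambda>x v. (F x v / N v) epowr q * (N v / D)"])
    also have "\<dots> \<le> D epowr q * (\<integral>\<^sup>+ v. N v / D \<partial>M2)"
      using unit by (intro mult_left_mono nn_integral_mono) auto
    also have "(\<integral>\<^sup>+ v. N v / D \<partial>M2) = 1"
      using 3 by (simp add: nn_integral_divide less_top flip: D_def)
    finally have "(\<integral>\<^sup>+ x. (\<integral>\<^sup>+ v. F x v \<partial>M2) epowr q \<partial>M1) epowr (1/q) \<le> (D epowr q) epowr (1/q)"
      using q0 by (intro epowr_mono) auto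
    thus ?thesis using q0 unfolding Lnorm_def[of M1 q "\<lambda>x. \<integral>\<^sup>+ v. F x v \<partial>M2"]
      by (simp add: D_def N_def)
  qed (simp add: D_def N_def)
qed

section \<open>Mixed norms and averages of translates\<close>

definition mixed_norm ::
  "real \<Rightarrow> real \<Rightarrow> ('a::euclidean_space \<times> 'b::euclidean_space \<Rightarrow> ennreal) \<Rightarrow> ennreal" where
  "mixed_norm p q F = Lnorm lborel p (\<lambda>x. Lnorm lborel q (\<lambda>y. F (x, y)))"

lemma Lpq_norm_eq_mixed_norm:
  "Lpq_norm p q f = mixed_norm p q (\<lambda>z. ennreal (cmod (f z)))"
  by (simp add: Lpq_norm_def mixed_norm_def Lnorm_def nn_integral_completion epowr_epowr)

lemma AE_lborel_pair:
  fixes Q :: "'a::euclidean_space \<times> 'b::euclidean_space \<Rightarrow> bool"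
  assumes "AE z in lborel. Q z"
  shows "AE x in lborel. AE y in lborel. Q (x, y)"
  using assms unfolding lborel_prod[symmetric] by (rule lborel_pair.AE_pair)

lemma mixed_norm_mono_AE:
  assumes "0 < p" "0 < q" "AE z in lborel. F z \<le> G z"
  shows "mixed_norm p q F \<le> mixed_norm p q G"
  using AE_lborel_pair[OF assms(3)] assms(1,2) unfolding mixed_norm_def
  by (intro Lnorm_mono_AE) (auto elim!: eventually_mono intro!: Lnorm_mono_AE)

lemma mixed_norm_cong_AE:
  assumes "0 < p" "0 < q" "AE z in lborel. F z = G z"
  shows "mixed_norm p q F = mixed_norm p q G"
  using assms by (intro antisym mixed_norm_mono_AE) (auto elim!: eventually_mono)

lemma measurable_Lnorm_section:
  assumes [measurable]: "(\<lambda>(x, y). F x y) \<in> borel_measurable (M \<Otimes>\<^sub>M lborel)"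
  shows "(\<lambda>x. Lnorm lborel q (\<lambda>y. F x y)) \<in> borel_measurable M"
  unfolding Lnorm_def by measurable

lemma mixed_norm_cmult:
  assumes pq: "0 < p" "0 < q" and [measurable]: "F \<in> borel_measurable borel"
  shows "mixed_norm p q (\<lambda>z. c * F z) = c * mixed_norm p q F"
proof -
  have [measurable]: "(\<lambda>x. Lnorm lborel q (\<lambda>y. F (x, y))) \<in> borel_measurable borel"
    by (intro measurable_Lnorm_section) measurable
  show ?thesis using pq by (simp add: mixed_norm_def Lnorm_cmult)
qed

lemma mixed_norm_eq_0D:
  assumes pq: "0 < p" "0 < q" and [measurable]: "F \<in> borel_measurable borel"
    and zero: "mixed_norm p q F = 0"
  shows "AE z in lborel. F z = 0"
proof -
  have m [measurable]: "(\<lambda>x. Lnorm lborel q (\<lambda>y. F (x, y))) \<in> borel_measurable borel"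
    by (intro measurable_Lnorm_section) measurable
  have "AE x in lborel. Lnorm lborel q (\<lambda>y. F (x, y)) = 0"
    using pq zero by (intro Lnorm_eq_0D[of p]) (auto simp: mixed_norm_def)
  hence "AE x in lborel. AE y in lborel. F (x, y) = 0"
    using pq by (auto elim!: eventually_mono intro!: Lnorm_eq_0D[of q])
  moreover have "{z \<in> space (lborel \<Otimes>\<^sub>M lborel). F z = 0} \<in> sets (lborel \<Otimes>\<^sub>M lborel)"
    unfolding lborel_prod by measurable
  ultimately have "AE z in lborel \<Otimes>\<^sub>M lborel. F z = 0"
    by (intro lborel_pair.AE_pair_measure) auto
  thus ?thesis unfolding lborel_prod .
qed

text \<open>Minkowski's inequality in the inner variable puts the integral outside the inner norm;
  a second application in the outer variable puts it outside the mixed norm.\<close>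

lemma mixed_norm_Minkowski:
  fixes F :: "'a::euclidean_space \<times> 'b::euclidean_space \<Rightarrow> 'v \<Rightarrow> ennreal"
  assumes p: "1 \<le> p" and q: "1 \<le> q" and L: "sigma_finite_measure L"
    and F: "case_prod F \<in> borel_measurable (borel \<Otimes>\<^sub>M L)"
  shows "mixed_norm p q (\<lambda>z. \<integral>\<^sup>+ v. F z v \<partial>L) \<le> (\<integral>\<^sup>+ v. mixed_norm p q (\<lambda>z. F z v) \<partial>L)"
proof -
  have Fm: "(\<lambda>w. F (g w) (h w)) \<in> borel_measurable N"
    if "g \<in> measurable N borel" "h \<in> measurable N L" for g h and N :: "'w measure"
    using measurable_compose[OF measurable_Pair[OF that] F] by simp
  interpret X: pair_sigma_finite "lborel :: 'a measure" L
    by (intro pair_sigma_finite.intro L sigma_finite_lborel)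
  interpret Y: pair_sigma_finite "lborel :: 'b measure" L
    by (intro pair_sigma_finite.intro L sigma_finite_lborel)
  have "mixed_norm p q (\<lambda>z. \<integral>\<^sup>+ v. F z v \<partial>L)
      \<le> Lnorm lborel p (\<lambda>x. \<integral>\<^sup>+ v. Lnorm lborel q (\<lambda>y. F (x, y) v) \<partial>L)"
    unfolding mixed_norm_def using p q
    by (intro Lnorm_mono_AE AE_I2 Y.Minkowski_integral_inequality)
       (auto simp: split_beta' intro!: Fm)
  also have "\<dots> \<le> (\<integral>\<^sup>+ v. Lnorm lborel p (\<lambda>x. Lnorm lborel q (\<lambda>y. F (x, y) v)) \<partial>L)"
  proof (rule X.Minkowski_integral_inequality[OF _ p])
    show "(\<lambda>(x, v). Lnorm lborel q (\<lambda>y. F (x, y) v)) \<in> borel_measurable (lborel \<Otimes>\<^sub>M L)"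
      unfolding split_beta'
      by (rule measurable_Lnorm_section) (auto simp: split_beta' intro!: Fm)
  qed
  finally show ?thesis by (simp add: mixed_norm_def)
qed

lemma mixed_norm_add:
  assumes p: "1 \<le> p" and q: "1 \<le> q"
    and [measurable]: "F \<in> borel_measurable borel" "G \<in> borel_measurable borel"
  shows "mixed_norm p q (\<lambda>z. F z + G z) \<le> mixed_norm p q F + mixed_norm p q G"
proof -
  \<comment> \<open>A sum of two terms is an integral over a two-point space.\<close>
  have two: "(\<integral>\<^sup>+ v. h v \<partial>count_space UNIV) = h True + h False" for h :: "bool \<Rightarrow> ennreal"
    by (simp add: nn_integral_count_space_finite UNIV_bool)
  have "mixed_norm p q (\<lambda>z. \<integral>\<^sup>+ v. (if v then F z else G z) \<partial>count_space UNIV)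
      \<le> (\<integral>\<^sup>+ v. mixed_norm p q (\<lambda>z. if v then F z else G z) \<partial>count_space UNIV)"
    using p q
    by (intro mixed_norm_Minkowski sigma_finite_measure_count_space_countable)
       auto
  thus ?thesis by (simp add: two)
qed

lemma nn_integral_lborel_translate:
  fixes f :: "'a::euclidean_space \<Rightarrow> ennreal"
  assumes [measurable]: "f \<in> borel_measurable borel"
  shows "(\<integral>\<^sup>+ x. f (x + t) \<partial>lborel) = (\<integral>\<^sup>+ x. f x \<partial>lborel)"
proof -
  have "(\<integral>\<^sup>+ x. f x \<partial>lborel) = (\<integral>\<^sup>+ x. f x \<partial>distr lborel borel ((+) t))"
    by (subst lborel_distr_plus) (rule refl)
  also have "\<dots> = (\<integral>\<^sup>+ x. f (x + t) \<partial>lborel)"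
    by (simp add: nn_integral_distr add.commute)
  finally show ?thesis by simp
qed

lemma Lnorm_translate:
  fixes f :: "'a::euclidean_space \<Rightarrow> ennreal"
  assumes [measurable]: "f \<in> borel_measurable borel"
  shows "Lnorm lborel q (\<lambda>x. f (x + t)) = Lnorm lborel q f"
  unfolding Lnorm_def by (subst nn_integral_lborel_translate) simp_all

lemma mixed_norm_translate:
  assumes [measurable]: "F \<in> borel_measurable borel"
  shows "mixed_norm p q (\<lambda>z. F (z + w)) = mixed_norm p q F"
proof -
  have m [measurable]: "(\<lambda>x. Lnorm lborel q (\<lambda>y. F (x, y))) \<in> borel_measurable borel"
    by (intro measurable_Lnorm_section) measurable
  have "Lnorm lborel q (\<lambda>y. F ((x, y) + w)) = Lnorm lborel q (\<lambda>y. F (x + fst w, y))" for x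
    using Lnorm_translate[of "\<lambda>y. F (x + fst w, y)" q "snd w"] by (simp add: plus_prod_def)
  thus ?thesis
    using Lnorm_translate[OF m, of p "fst w"] by (simp add: mixed_norm_def)
qed

text \<open>Young's inequality for convolutions, in a form that also covers averages such as
  \<open>\<integral> F (z + a u) \<bar>\<psi> u\<bar> du\<close> without a change of variables.\<close>

lemma mixed_norm_average_of_translates:
  fixes F :: "'a::euclidean_space \<times> 'b::euclidean_space \<Rightarrow> ennreal"
  assumes p: "1 \<le> p" and q: "1 \<le> q" and L: "sigma_finite_measure L"
    and [measurable]: "F \<in> borel_measurable borel" "\<tau> \<in> borel_measurable L"
  shows "mixed_norm p q (\<lambda>z. \<integral>\<^sup>+ v. F (z + \<tau> v) \<partial>L) \<le> emeasure L (space L) * mixed_norm p q F"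
proof -
  have "mixed_norm p q (\<lambda>z. \<integral>\<^sup>+ v. F (z + \<tau> v) \<partial>L) \<le> (\<integral>\<^sup>+ v. mixed_norm p q (\<lambda>z. F (z + \<tau> v)) \<partial>L)"
    by (rule mixed_norm_Minkowski[OF p q L]) measurable
  also have "\<dots> = (\<integral>\<^sup>+ v. mixed_norm p q F \<partial>L)"
    by (simp add: mixed_norm_translate)
  finally show ?thesis by (simp add: mult.commute)
qed

section \<open>The space as a normed space modulo null sets\<close>

text \<open>The sections of a Lebesgue measurable function need not be measurable, so the results on
  mixed norms are stated for Borel functions and are transferred through a Borel representative
  of the modulus.\<close>

lemma cmod_ex_borel:
  assumes "f \<in> borel_measurable (lebesgue :: 'a::euclidean_space measure)"
  obtains g where "g \<in> borel_measurable borel" "AE z in lborel. ennreal (cmod (f z)) = g z"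
proof -
  have "(\<lambda>z. ennreal (cmod (f z))) \<in> borel_measurable (completion lborel)"
    using assms by measurable
  from completion_ex_borel_measurable[OF this] that show ?thesis by auto
qed

lemma Lpq_norm_mono_AE:
  assumes "0 < p" "0 < q" "AE z in lebesgue. cmod (f z) \<le> cmod (g z)"
  shows "Lpq_norm p q f \<le> Lpq_norm p q g"
  using assms unfolding Lpq_norm_eq_mixed_norm
  by (intro mixed_norm_mono_AE) (auto simp: AE_completion_iff elim!: eventually_mono intro!: ennreal_leI)

lemma Lpq_norm_cong_AE:
  assumes "0 < p" "0 < q" "AE z in lebesgue. f z = g z"
  shows "Lpq_norm p q f = Lpq_norm p q g"
  using assms by (intro antisym Lpq_norm_mono_AE) (auto elim!: eventually_mono)

lemma Lpq_norm_triangle: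
  assumes p: "1 \<le> p" and q: "1 \<le> q"
    and f: "f \<in> borel_measurable lebesgue" and g: "g \<in> borel_measurable lebesgue"
  shows "Lpq_norm p q (\<lambda>z. f z + g z) \<le> Lpq_norm p q f + Lpq_norm p q g"
proof -
  from cmod_ex_borel[OF f] obtain F where
    F [measurable]: "F \<in> borel_measurable borel" and fF: "AE z in lborel. ennreal (cmod (f z)) = F z" .
  from cmod_ex_borel[OF g] obtain G where
    G [measurable]: "G \<in> borel_measurable borel" and gG: "AE z in lborel. ennreal (cmod (g z)) = G z" .
  have "AE z in lborel. ennreal (cmod (f z + g z)) \<le> F z + G z"
    using fF gG
  proof eventually_elim
    case (elim z)
    have "ennreal (cmod (f z + g z)) \<le> ennreal (cmod (f z)) + ennreal (cmod (g z))"
      by (simp add: norm_triangle_ineq flip: ennreal_plus)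
    thus ?case using elim by simp
  qed
  hence "Lpq_norm p q (\<lambda>z. f z + g z) \<le> mixed_norm p q (\<lambda>z. F z + G z)"
    unfolding Lpq_norm_eq_mixed_norm using p q by (intro mixed_norm_mono_AE) auto
  also have "\<dots> \<le> mixed_norm p q F + mixed_norm p q G"
    using p q by (intro mixed_norm_add) auto
  also have "mixed_norm p q F = Lpq_norm p q f"
    unfolding Lpq_norm_eq_mixed_norm using p q fF
    by (intro mixed_norm_cong_AE) (auto elim!: eventually_mono)
  also have "mixed_norm p q G = Lpq_norm p q g"
    unfolding Lpq_norm_eq_mixed_norm using p q gG
    by (intro mixed_norm_cong_AE) (auto elim!: eventually_mono)
  finally show ?thesis .
qed

lemma Lpq_norm_eq_0D:
  assumes "0 < p" "0 < q" and f: "f \<in> borel_measurable lebesgue" and "Lpq_norm p q f = 0"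
  shows "AE z in lebesgue. f z = 0"
proof -
  from cmod_ex_borel[OF f] obtain F where
    F [measurable]: "F \<in> borel_measurable borel" and fF: "AE z in lborel. ennreal (cmod (f z)) = F z" .
  have "mixed_norm p q F = Lpq_norm p q f"
    unfolding Lpq_norm_eq_mixed_norm using assms fF
    by (intro mixed_norm_cong_AE) (auto elim!: eventually_mono)
  hence "AE z in lborel. F z = 0"
    using assms by (intro mixed_norm_eq_0D[of p q]) auto
  with fF have "AE z in lborel. f z = 0"
    by eventually_elim (metis ennreal_eq_0_iff norm_le_zero_iff)
  thus ?thesis by (simp add: AE_completion_iff)
qed

lemma Lpq_norm_cmult:
  assumes "0 < p" "0 < q" and f: "f \<in> borel_measurable lebesgue"
  shows "Lpq_norm p q (\<lambda>z. t * f z) = ennreal (cmod t) * Lpq_norm p q f"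
proof -
  from cmod_ex_borel[OF f] obtain F where
    F [measurable]: "F \<in> borel_measurable borel" and fF: "AE z in lborel. ennreal (cmod (f z)) = F z" .
  have "Lpq_norm p q (\<lambda>z. t * f z) = mixed_norm p q (\<lambda>z. ennreal (cmod t) * F z)"
    unfolding Lpq_norm_eq_mixed_norm using assms fF
    by (intro mixed_norm_cong_AE) (auto simp: norm_mult ennreal_mult elim!: eventually_mono)
  also have "\<dots> = ennreal (cmod t) * mixed_norm p q F"
    using assms by (intro mixed_norm_cmult) auto
  also have "mixed_norm p q F = Lpq_norm p q f"
    unfolding Lpq_norm_eq_mixed_norm using assms fF
    by (intro mixed_norm_cong_AE) (auto elim!: eventually_mono)
  finally show ?thesis .
qed

lemma Lpq_add:
  assumes "1 \<le> p" "1 \<le> q" "f \<in> Lpq p q" "g \<in> Lpq p q"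
  shows "(\<lambda>z. f z + g z) \<in> Lpq p q"
  using assms Lpq_norm_triangle[of p q f g]
  by (auto simp: Lpq_def less_top[symmetric] top_unique ennreal_add_eq_top)

lemma Lpq_cmult:
  assumes "1 \<le> p" "1 \<le> q" "f \<in> Lpq p q"
  shows "(\<lambda>z. t * f z) \<in> Lpq p q"
  using assms Lpq_norm_cmult[of p q f t]
  by (auto simp: Lpq_def ennreal_mult_less_top)

lemma Lpq_diff:
  assumes "1 \<le> p" "1 \<le> q" "f \<in> Lpq p q" "g \<in> Lpq p q"
  shows "(\<lambda>z. f z - g z) \<in> Lpq p q"
  using Lpq_add[OF assms(1-3) Lpq_cmult[OF assms(1,2,4), of "-1"]] by simp

section \<open>Coefficient control in finite-dimensional spaces of continuous functions\<close>

lemma AE_zero_on_open_imp_zero: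
  fixes h :: "'a::euclidean_space \<Rightarrow> 'b::real_normed_vector"
  assumes h: "continuous_on UNIV h" and B: "open B" and ae: "AE z in lborel. z \<in> B \<longrightarrow> h z = 0"
    and z: "z \<in> B"
  shows "h z = 0"
proof (rule ccontr)
  assume "h z \<noteq> 0"
  define U where "U = B \<inter> h -` (- {0})"
  have "open U"
    unfolding U_def by (intro open_Int B open_vimage h) auto
  moreover have "U \<in> null_sets lborel"
    using ae \<open>open U\<close> AE_iff_null_sets[of U lborel] by (auto simp: U_def elim: eventually_mono)
  hence "negligible U"
    unfolding negligible_iff_null_sets by (rule null_sets_completionI)
  ultimately have "U = {}"
    using open_not_negligible by blast
  thus False using \<open>h z \<noteq> 0\<close> z by (auto simp: U_def)
qed

lemma integrable_on_ball:
  fixes h :: "'a::euclidean_space \<Rightarrow> real"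
  assumes "continuous_on UNIV h"
  shows "integrable lborel (\<lambda>z. indicator (ball 0 \<rho>) z * h z)"
proof -
  have "set_integrable lborel (cball 0 \<rho>) h"
    unfolding set_integrable_def using assms
    by (intro borel_integrable_compact compact_cball) (auto intro: continuous_on_subset)
  hence "set_integrable lborel (ball 0 \<rho>) h"
    by (rule set_integrable_subset) auto
  thus ?thesis by (simp add: set_integrable_def)
qed

text \<open>On the unit sphere of coefficients, which is compact, the \<open>L\<^sup>1\<close> norm of the combination is
  continuous, and it is positive by independence. Its minimum \<open>\<mu>\<close> gives the constant \<open>1 / \<mu>\<close> by
  homogeneity.\<close>

lemma independent_coefficient_bound:
  fixes g :: "'i \<Rightarrow> 'a::euclidean_space \<Rightarrow> complex"
  assumes T: "finite T" and g: "\<And>j. j \<in> T \<Longrightarrow> continuous_on UNIV (g j)"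
    and indep: "\<And>d. (\<And>z. z \<in> ball 0 \<rho> \<Longrightarrow> (\<Sum>j\<in>T. d j * g j z) = 0) \<Longrightarrow> \<forall>j\<in>T. d j = 0"
  obtains C where "0 \<le> C"
    "\<And>d. (\<Sum>j\<in>T. cmod (d j)) \<le> C * (LINT z|lborel. indicator (ball 0 \<rho>) z * cmod (\<Sum>j\<in>T. d j * g j z))"
proof -
  define I where "I d = (LINT z|lborel. indicator (ball 0 \<rho>) z * cmod (\<Sum>j\<in>T. d j * g j z))" for d
  define \<nu> where "\<nu> d = (\<Sum>j\<in>T. cmod (d j))" for d :: "'i \<Rightarrow> complex"
  define G where "G j = (LINT z|lborel. indicator (ball 0 \<rho>) z * cmod (g j z))" for j
  have int: "integrable lborel (\<lambda>z. indicator (ball 0 \<rho>) z * cmod (\<Sum>j\<in>T. d j * g j z))" for d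
    by (intro integrable_on_ball continuous_intros g)
  have intg: "integrable lborel (\<lambda>z. indicator (ball 0 \<rho>) z * cmod (g j z))" if "j \<in> T" for j
    by (intro integrable_on_ball continuous_intros g that)
  have I_nonneg: "0 \<le> I d" for d
    unfolding I_def by (intro Bochner_Integration.integral_nonneg) auto
  have Lip: "I d \<le> I e + (\<Sum>j\<in>T. cmod (d j - e j) * G j)" for d e
  proof -
    have "I d \<le> (LINT z|lborel. indicator (ball 0 \<rho>) z * cmod (\<Sum>j\<in>T. e j * g j z)
              + (\<Sum>j\<in>T. cmod (d j - e j) * (indicator (ball 0 \<rho>) z * cmod (g j z))))"
      unfolding I_def
    proof (rule integral_mono)
      fix z
      have "(\<Sum>j\<in>T. d j * g j z) = (\<Sum>j\<in>T. e j * g j z) + (\<Sum>j\<in>T. (d j - e j) * g j z)"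
        by (simp add: algebra_simps flip: sum.distrib)
      hence "cmod (\<Sum>j\<in>T. d j * g j z)
          = cmod ((\<Sum>j\<in>T. e j * g j z) + (\<Sum>j\<in>T. (d j - e j) * g j z))" by simp
      hence "cmod (\<Sum>j\<in>T. d j * g j z) \<le> cmod (\<Sum>j\<in>T. e j * g j z) + (\<Sum>j\<in>T. cmod ((d j - e j) * g j z))"
        using norm_triangle_ineq[of "\<Sum>j\<in>T. e j * g j z" "\<Sum>j\<in>T. (d j - e j) * g j z"]
          norm_sum[of "\<lambda>j. (d j - e j) * g j z" T] by linarith
      thus "indicator (ball 0 \<rho>) z * cmod (\<Sum>j\<in>T. d j * g j z)
          \<le> indicator (ball 0 \<rho>) z * cmod (\<Sum>j\<in>T. e j * g j z)
             + (\<Sum>j\<in>T. cmod (d j - e j) * (indicator (ball 0 \<rho>) z * cmod (g j z)))"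
        by (auto simp: indicator_def norm_mult)
    qed (intro int intg Bochner_Integration.integrable_add Bochner_Integration.integrable_sum
           integrable_mult_right | assumption)+
    also have "\<dots> = I e + (\<Sum>j\<in>T. cmod (d j - e j) * G j)"
      using int intg by (simp add: I_def G_def)
    finally show ?thesis .
  qed
  have contI: "continuous_on UNIV I"
    unfolding continuous_on_def
  proof
    fix e :: "'i \<Rightarrow> complex"
    have "((\<lambda>d. I d - I e) \<longlongrightarrow> 0) (at e)"
    proof (rule Lim_null_comparison)
      show "\<forall>\<^sub>F d in at e. norm (I d - I e) \<le> (\<Sum>j\<in>T. cmod (d j - e j) * G j)"
      proof (intro always_eventually allI)
        fix d
        have "I e \<le> I d + (\<Sum>j\<in>T. cmod (d j - e j) * G j)"
          using Lip[of e d] by (simp add: norm_minus_commute)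
        with Lip[of d e] show "norm (I d - I e) \<le> (\<Sum>j\<in>T. cmod (d j - e j) * G j)" by simp
      qed
      have "((\<lambda>d. d j) \<longlongrightarrow> e j) (at e)" for j
        using continuous_on_product_coordinates[of j] by (auto simp: continuous_on_def)
      hence "((\<lambda>d. \<Sum>j\<in>T. cmod (d j - e j) * G j) \<longlongrightarrow> (\<Sum>j\<in>T. cmod (e j - e j) * G j)) (at e)"
        by (intro tendsto_intros) auto
      thus "((\<lambda>d. \<Sum>j\<in>T. cmod (d j - e j) * G j) \<longlongrightarrow> 0) (at e)" by simp
    qed
    thus "(I \<longlongrightarrow> I e) (at e within UNIV)" by (simp add: LIM_zero_iff)
  qed
  \<comment> \<open>Coefficients outside \<open>T\<close> are set to 0, so that the sphere is compact in the product topology.\<close>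
  define Box where "Box = PiE UNIV (\<lambda>j. if j \<in> T then cball (0::complex) 1 else {0})"
  define Sph where "Sph = Box \<inter> {d. \<nu> d = 1}"
  have "compact Box"
    using compactin_PiE[of "\<lambda>_. euclidean" UNIV "\<lambda>j. if j \<in> T then cball (0::complex) 1 else {0}"]
    by (auto simp: Box_def euclidean_product_topology)
  moreover have "closed {d. \<nu> d = 1}"
    unfolding \<nu>_def by (intro closed_Collect_eq continuous_intros continuous_on_product_coordinates)
  ultimately have Sph: "compact Sph" unfolding Sph_def by (rule compact_Int_closed)
  obtain \<mu> where \<mu>: "0 < \<mu>" "\<And>d. d \<in> Sph \<Longrightarrow> \<mu> \<le> I d"
  proof (cases "Sph = {}")
    case False
    from continuous_attains_inf[OF Sph this continuous_on_subset[OF contI]] obtain d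
      where d: "d \<in> Sph" "\<And>e. e \<in> Sph \<Longrightarrow> I d \<le> I e" by auto
    have "I d \<noteq> 0"
    proof
      assume "I d = 0"
      hence "AE z in lborel. indicator (ball 0 \<rho>) z * cmod (\<Sum>j\<in>T. d j * g j z) = 0"
        using integral_nonneg_eq_0_iff_AE[OF int[of d]] by (simp add: I_def)
      hence "AE z in lborel. z \<in> ball 0 \<rho> \<longrightarrow> (\<Sum>j\<in>T. d j * g j z) = 0"
        by (auto elim!: eventually_mono)
      moreover have "continuous_on UNIV (\<lambda>z. \<Sum>j\<in>T. d j * g j z)"
        by (intro continuous_intros g)
      ultimately have "\<And>z. z \<in> ball 0 \<rho> \<Longrightarrow> (\<Sum>j\<in>T. d j * g j z) = 0"
        using AE_zero_on_open_imp_zero[of "\<lambda>z. \<Sum>j\<in>T. d j * g j z" "ball 0 \<rho>"] by blast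
      from indep[OF this] have "\<nu> d = 0" by (simp add: \<nu>_def)
      thus False using d by (simp add: Sph_def)
    qed
    thus ?thesis using that[of "I d"] d I_nonneg[of d] by (simp add: less_le)
  qed (use that[of 1] in auto)
  show ?thesis
  proof (rule that[of "1 / \<mu>"])
    fix d
    show "(\<Sum>j\<in>T. cmod (d j)) \<le> 1 / \<mu> * (LINT z|lborel. indicator (ball 0 \<rho>) z * cmod (\<Sum>j\<in>T. d j * g j z))"
    proof (cases "\<nu> d = 0")
      case False
      define s where "s = \<nu> d"
      have s: "s > 0" using False by (simp add: s_def \<nu>_def less_le sum_nonneg)
      define e where "e j = (if j \<in> T then d j / of_real s else 0)" for j
      have "\<nu> e = 1"
        using s by (simp add: \<nu>_def e_def norm_divide flip: sum_divide_distrib)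
           (simp add: s_def \<nu>_def)
      moreover have "cmod (e j) \<le> 1" if "j \<in> T" for j
        using member_le_sum[OF that, of "\<lambda>j. cmod (e j)"] T \<open>\<nu> e = 1\<close> by (simp add: \<nu>_def)
      ultimately have "e \<in> Sph"
        by (auto simp: Sph_def Box_def PiE_def Pi_def extensional_def e_def)
      hence "\<mu> \<le> I e" by (rule \<mu>)
      also have "I e = I d / s"
      proof -
        have "(\<Sum>j\<in>T. e j * g j z) = (\<Sum>j\<in>T. d j * g j z) / of_real s" for z
          by (simp add: e_def sum_divide_distrib)
        thus ?thesis using s by (simp add: I_def norm_divide flip: Bochner_Integration.integral_divide_zero)
      qed
      finally have "\<nu> d \<le> 1 / \<mu> * I d"
        using \<mu>(1) s by (simp add: field_simps s_def)
      thus ?thesis by (simp add: \<nu>_def I_def)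
    qed (use I_nonneg[of d] \<mu>(1) in \<open>simp add: \<nu>_def I_def\<close>)
  qed (use \<mu>(1) in auto)
qed

text \<open>The integer translates of the generators may be linearly dependent on a ball, so the
  coefficients of a function are not determined by it; the bound can only hold for a suitable
  choice of them. A spanning subfamily of least size is independent, and the coefficients with
  respect to that subfamily, extended by 0, are bounded.\<close>

lemma span_coefficient_bound:
  fixes g :: "'i \<Rightarrow> 'a::euclidean_space \<Rightarrow> complex"
  assumes S: "finite S" and g: "\<And>j. j \<in> S \<Longrightarrow> continuous_on UNIV (g j)"
  obtains C where "0 \<le> C"
    "\<And>c. \<exists>d. (\<forall>z\<in>ball 0 \<rho>. (\<Sum>j\<in>S. c j * g j z) = (\<Sum>j\<in>S. d j * g j z)) \<and>
       ennreal (\<Sum>j\<in>S. cmod (d j))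
         \<le> ennreal C * (\<integral>\<^sup>+ z. indicator (ball 0 \<rho>) z * ennreal (cmod (\<Sum>j\<in>S. c j * g j z)) \<partial>lborel)"
proof -
  define spans where "spans T \<longleftrightarrow>
    T \<subseteq> S \<and> (\<forall>c. \<exists>d. \<forall>z\<in>ball 0 \<rho>. (\<Sum>j\<in>S. c j * g j z) = (\<Sum>j\<in>T. d j * g j z))" for T
  have "spans S" by (auto simp: spans_def)
  from ex_has_least_nat[of spans, OF this, of card] obtain T
    where T: "spans T" and least: "\<And>U. spans U \<Longrightarrow> card T \<le> card U" by blast
  have TS: "T \<subseteq> S" and finT: "finite T"
    using T S by (auto simp: spans_def intro: finite_subset)
  have indep: "\<forall>j\<in>T. d j = 0" if d: "\<And>z. z \<in> ball 0 \<rho> \<Longrightarrow> (\<Sum>j\<in>T. d j * g j z) = 0" for d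
  proof (rule ccontr)
    assume "\<not> (\<forall>j\<in>T. d j = 0)"
    then obtain k where k: "k \<in> T" "d k \<noteq> 0" by auto
    have "spans (T - {k})"
      unfolding spans_def
    proof safe
      fix c
      from T obtain e where e: "\<And>z. z \<in> ball 0 \<rho> \<Longrightarrow> (\<Sum>j\<in>S. c j * g j z) = (\<Sum>j\<in>T. e j * g j z)"
        unfolding spans_def by blast
      show "\<exists>d. \<forall>z\<in>ball 0 \<rho>. (\<Sum>j\<in>S. c j * g j z) = (\<Sum>j\<in>T - {k}. d j * g j z)"
      proof (intro exI ballI)
        fix z assume z: "z \<in> ball (0::'a) \<rho>"
        have "(\<Sum>j\<in>S. c j * g j z) = (\<Sum>j\<in>T. e j * g j z) - e k / d k * (\<Sum>j\<in>T. d j * g j z)"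
          using e[OF z] d[OF z] by simp
        also have "\<dots> = (\<Sum>j\<in>T. (e j - e k / d k * d j) * g j z)"
          by (simp add: algebra_simps sum_subtractf sum_distrib_left)
        also have "\<dots> = (\<Sum>j\<in>T - {k}. (e j - e k / d k * d j) * g j z)"
          using k finT by (simp add: sum.remove[of T k])
        finally show "(\<Sum>j\<in>S. c j * g j z) = (\<Sum>j\<in>T - {k}. (e j - e k / d k * d j) * g j z)" .
      qed
    qed (use TS in auto)
    from least[OF this] show False
      using k finT card_Diff1_less[of T k] by simp
  qed
  obtain C where C: "0 \<le> C"
    "\<And>d. (\<Sum>j\<in>T. cmod (d j)) \<le> C * (LINT z|lborel. indicator (ball 0 \<rho>) z * cmod (\<Sum>j\<in>T. d j * g j z))"
  proof (rule independent_coefficient_bound[OF finT])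
    show "continuous_on UNIV (g j)" if "j \<in> T" for j using g TS that by auto
  qed (rule indep, assumption, rule that)
  show ?thesis
  proof (rule that[OF C(1)])
    fix c
    from T obtain e where e: "\<And>z. z \<in> ball 0 \<rho> \<Longrightarrow> (\<Sum>j\<in>S. c j * g j z) = (\<Sum>j\<in>T. e j * g j z)"
      unfolding spans_def by blast
    define d where "d j = (if j \<in> T then e j else 0)" for j
    have dT: "(\<Sum>j\<in>S. d j * g j z) = (\<Sum>j\<in>T. e j * g j z)" for z
      using TS S by (intro sum.mono_neutral_cong_right) (auto simp: d_def)
    have "(\<Sum>j\<in>S. cmod (d j)) = (\<Sum>j\<in>T. cmod (e j))"
      using TS S by (intro sum.mono_neutral_cong_right) (auto simp: d_def)
    also have "\<dots> \<le> C * (LINT z|lborel. indicator (ball 0 \<rho>) z * cmod (\<Sum>j\<in>T. e j * g j z))"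
      by (rule C)
    finally have "ennreal (\<Sum>j\<in>S. cmod (d j))
        \<le> ennreal C * ennreal (LINT z|lborel. indicator (ball 0 \<rho>) z * cmod (\<Sum>j\<in>T. e j * g j z))"
      using C(1) by (simp add: ennreal_leI flip: ennreal_mult')
    also have "ennreal (LINT z|lborel. indicator (ball 0 \<rho>) z * cmod (\<Sum>j\<in>T. e j * g j z))
        = (\<integral>\<^sup>+ z. ennreal (indicator (ball 0 \<rho>) z * cmod (\<Sum>j\<in>T. e j * g j z)) \<partial>lborel)"
      using TS by (intro nn_integral_eq_integral[symmetric] integrable_on_ball continuous_intros g) auto
    also have "\<dots> = (\<integral>\<^sup>+ z. indicator (ball 0 \<rho>) z * ennreal (cmod (\<Sum>j\<in>S. c j * g j z)) \<partial>lborel)"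
      by (intro nn_integral_cong) (auto simp: indicator_def e)
    finally show "\<exists>d. (\<forall>z\<in>ball 0 \<rho>. (\<Sum>j\<in>S. c j * g j z) = (\<Sum>j\<in>S. d j * g j z)) \<and>
       ennreal (\<Sum>j\<in>S. cmod (d j))
         \<le> ennreal C * (\<integral>\<^sup>+ z. indicator (ball 0 \<rho>) z * ennreal (cmod (\<Sum>j\<in>S. c j * g j z)) \<partial>lborel)"
      using e dT by (intro exI[of _ d]) auto
  qed
qed

section \<open>Local structure of shift-invariant spaces\<close>

definition lattice_pt :: "'n::finite index \<Rightarrow> 'n point" where
  "lattice_pt k = (real_of_int (fst k), of_int_vec (snd k))"

lemma lattice_pt_add: "lattice_pt (k + m) = lattice_pt k + lattice_pt m"
  by (simp add: lattice_pt_def of_int_vec_def vec_eq_iff plus_prod_def)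

lemma finite_lattice_ball: "finite {k :: 'n::finite index. norm (lattice_pt k) \<le> R}"
proof -
  define N where "N = \<lceil>R\<rceil>"
  have "k \<in> {- N..N} \<times> (vec_lambda ` (PiE UNIV (\<lambda>_. {- N..N})))"
    if k: "norm (lattice_pt k) \<le> R" for k :: "'n index"
  proof -
    have bound: "i \<in> {- N..N}" if "\<bar>real_of_int i\<bar> \<le> R" for i
      using that unfolding N_def by (auto simp: le_ceiling_iff) linarith+
    have "norm (fst (lattice_pt k)) \<le> norm (lattice_pt k)" "norm (snd (lattice_pt k)) \<le> norm (lattice_pt k)"
      by (metis norm_fst_le norm_snd_le prod.collapse)+
    hence 1: "\<bar>real_of_int (fst k)\<bar> \<le> R" and 2: "norm (of_int_vec (snd k)) \<le> R"
      using k by (auto simp: lattice_pt_def)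
    have "\<bar>real_of_int (snd k $ i)\<bar> \<le> R" for i
      using component_le_norm_cart[of "of_int_vec (snd k)" i] 2 by (simp add: of_int_vec_def)
    hence "vec_nth (snd k) \<in> PiE UNIV (\<lambda>_. {- N..N})"
      using bound by auto
    hence "snd k \<in> vec_lambda ` (PiE UNIV (\<lambda>_. {- N..N}))"
      by (rule rev_image_eqI) simp
    thus ?thesis using bound[OF 1] by (cases k) simp
  qed
  hence "{k :: 'n index. norm (lattice_pt k) \<le> R} \<subseteq> {- N..N} \<times> (vec_lambda ` (PiE UNIV (\<lambda>_. {- N..N})))"
    by blast
  thus ?thesis by (rule finite_subset) (intro finite_cartesian_product finite_imageI finite_PiE; simp)
qed

lemma lattice_pt_near:
  fixes z :: "'n::finite point"
  shows "\<exists>m. norm (z - lattice_pt m) \<le> 1 + real CARD('n)"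
proof -
  define m :: "'n index" where "m = (\<lfloor>fst z\<rfloor>, \<chi> i. \<lfloor>snd z $ i\<rfloor>)"
  have fl: "\<bar>t - real_of_int \<lfloor>t\<rfloor>\<bar> \<le> 1" for t :: real by linarith
  have "z - lattice_pt m = (fst z - real_of_int \<lfloor>fst z\<rfloor>, snd z - of_int_vec (snd m))"
    by (simp add: m_def lattice_pt_def minus_prod_def)
  hence "norm (z - lattice_pt m) \<le> norm (fst z - real_of_int \<lfloor>fst z\<rfloor>) + norm (snd z - of_int_vec (snd m))"
    by (simp only: norm_Pair_le)
  also have "norm (snd z - of_int_vec (snd m)) \<le> (\<Sum>i\<in>UNIV. \<bar>(snd z - of_int_vec (snd m)) $ i\<bar>)"
    by (rule norm_le_l1_cart)
  also have "\<dots> \<le> (\<Sum>i\<in>(UNIV :: 'n set). 1)"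
    using fl by (intro sum_mono) (simp add: m_def of_int_vec_def del: abs_le_iff)
  also have "norm (fst z - real_of_int \<lfloor>fst z\<rfloor>) \<le> 1" using fl by simp
  finally show ?thesis by (intro exI[of _ m]) simp
qed

lemma shift_comb_eq:
  "shift_comb r \<Phi> c z = (\<Sum>i=1..r. \<Sum>\<^sub>\<infinity>k\<in>UNIV. c i k * \<Phi> i (z - lattice_pt k))"
  by (cases z) (simp add: shift_comb_def lattice_pt_def split_beta')

text \<open>Translating by a lattice point only shifts the coefficients, so the same finite set \<open>K\<close>
  serves the balls around all lattice points. This uniformity yields one constant for all
  of space.\<close>

lemma shift_comb_locally_finite:
  fixes \<Phi> :: "nat \<Rightarrow> 'n::finite point \<Rightarrow> complex"
  assumes \<Phi>: "\<And>i. i \<in> {1..r} \<Longrightarrow> compact (supp (\<Phi> i))"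
  obtains K where "finite K"
    "\<And>c m z. norm z < \<rho> \<Longrightarrow> shift_comb r \<Phi> c (z + lattice_pt m)
       = (\<Sum>(i, k)\<in>{1..r} \<times> K. c i (k + m) * \<Phi> i (z - lattice_pt k))"
proof -
  have "bounded (\<Union>i\<in>{1..r}. supp (\<Phi> i))"
    by (intro bounded_UN compact_imp_bounded ballI \<Phi>) auto
  then obtain R where R: "\<And>i z. i \<in> {1..r} \<Longrightarrow> z \<in> supp (\<Phi> i) \<Longrightarrow> norm z \<le> R"
    unfolding bounded_iff by blast
  have zero: "\<Phi> i w = 0" if "i \<in> {1..r}" "norm w > R" for i w
  proof (rule ccontr)
    assume "\<Phi> i w \<noteq> 0"
    hence "w \<in> supp (\<Phi> i)" by (auto simp: supp_def intro: closure_subset[THEN subsetD])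
    from R[OF that(1) this] that(2) show False by simp
  qed
  define K where "K = {k :: 'n index. norm (lattice_pt k) \<le> R + \<rho>}"
  show ?thesis
  proof (rule that)
    show finK: "finite K" unfolding K_def by (rule finite_lattice_ball)
    fix c m z assume z: "norm (z :: 'n point) < \<rho>"
    have "(\<Sum>\<^sub>\<infinity>k\<in>UNIV. c i k * \<Phi> i (z + lattice_pt m - lattice_pt k))
        = (\<Sum>k\<in>K. c i (k + m) * \<Phi> i (z - lattice_pt k))" if i: "i \<in> {1..r}" for i
    proof -
      have out: "\<Phi> i (z + lattice_pt m - lattice_pt k) = 0" if "k \<notin> (\<lambda>k. k + m) ` K" for k
      proof (rule zero[OF i])
        have "k - m \<notin> K" using that by (metis diff_add_cancel rev_image_eqI)
        hence "R + \<rho> < norm (lattice_pt (k - m))" by (simp add: K_def)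
        moreover have "lattice_pt (k - m) = lattice_pt k - lattice_pt m"
          using lattice_pt_add[of "k - m" m] by simp
        moreover have "norm (lattice_pt k - lattice_pt m) \<le> norm z + norm (z + lattice_pt m - lattice_pt k)"
          using norm_triangle_ineq4[of z "z + lattice_pt m - lattice_pt k"] by (simp add: algebra_simps)
        ultimately show "R < norm (z + lattice_pt m - lattice_pt k)" using z by simp
      qed
      have "(\<Sum>\<^sub>\<infinity>k\<in>UNIV. c i k * \<Phi> i (z + lattice_pt m - lattice_pt k))
          = (\<Sum>\<^sub>\<infinity>k\<in>(\<lambda>k. k + m) ` K. c i k * \<Phi> i (z + lattice_pt m - lattice_pt k))"
        by (intro infsum_cong_neutral) (auto simp: out)
      also have "\<dots> = (\<Sum>k\<in>(\<lambda>k. k + m) ` K. c i k * \<Phi> i (z + lattice_pt m - lattice_pt k))"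
        using finK by simp
      also have "\<dots> = (\<Sum>k\<in>K. c i (k + m) * \<Phi> i (z - lattice_pt k))"
        by (subst sum.reindex) (auto simp: lattice_pt_add)
      finally show ?thesis .
    qed
    thus "shift_comb r \<Phi> c (z + lattice_pt m)
       = (\<Sum>(i, k)\<in>{1..r} \<times> K. c i (k + m) * \<Phi> i (z - lattice_pt k))"
      by (simp add: shift_comb_eq sum.cartesian_product)
  qed
qed

lemma continuous_shift_comb:
  fixes \<Phi> :: "nat \<Rightarrow> 'n::finite point \<Rightarrow> complex"
  assumes \<Phi>: "\<And>i. i \<in> {1..r} \<Longrightarrow> compact (supp (\<Phi> i))"
    and cont: "\<And>i. i \<in> {1..r} \<Longrightarrow> continuous_on UNIV (\<Phi> i)"
  shows "continuous_on UNIV (shift_comb r \<Phi> c)"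
proof (rule continuous_at_imp_continuous_on, rule ballI)
  fix z :: "'n point"
  obtain K where K: "finite K"
    "\<And>c m w. norm w < norm z + 1 \<Longrightarrow> shift_comb r \<Phi> c (w + lattice_pt m)
       = (\<Sum>(i, k)\<in>{1..r} \<times> K. c i (k + m) * \<Phi> i (w - lattice_pt k))"
    by (rule shift_comb_locally_finite[where \<rho> = "norm z + 1" and r = r and \<Phi> = \<Phi>])
       (erule \<Phi>, rule that)
  have eq: "shift_comb r \<Phi> c w = (\<Sum>(i, k)\<in>{1..r} \<times> K. c i k * \<Phi> i (w - lattice_pt k))"
    if "w \<in> ball 0 (norm z + 1)" for w
    using K(2)[of w c 0] that by (simp add: lattice_pt_def of_int_vec_def zero_prod_def[symmetric] zero_vec_def[symmetric])
  have "continuous_on (ball 0 (norm z + 1)) (\<lambda>w. \<Sum>(i, k)\<in>{1..r} \<times> K. c i k * \<Phi> i (w - lattice_pt k))"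
    unfolding split_beta'
    by (intro continuous_intros continuous_on_compose2[OF cont]) auto
  hence "continuous_on (ball 0 (norm z + 1)) (shift_comb r \<Phi> c)"
    by (rule continuous_on_eq) (simp add: eq)
  thus "isCont (shift_comb r \<Phi> c) z"
    by (simp add: continuous_on_eq_continuous_at)
qed

definition local_mass :: "real \<Rightarrow> ('a::euclidean_space \<Rightarrow> complex) \<Rightarrow> 'a \<Rightarrow> ennreal" where
  "local_mass \<rho> f z = (\<integral>\<^sup>+ h. indicator (cball 0 \<rho>) h * ennreal (cmod (f (z + h))) \<partial>lborel)"

lemma finite_family_bounded:
  fixes g :: "'i \<Rightarrow> 'a::euclidean_space \<Rightarrow> complex"
  assumes "finite S" "\<And>j. j \<in> S \<Longrightarrow> continuous_on UNIV (g j)"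
  obtains M where "0 \<le> M" "\<And>j (w::'a). j \<in> S \<Longrightarrow> w \<in> ball 0 \<rho> \<Longrightarrow> cmod (g j w) \<le> M"
proof -
  have "bounded (\<Union>j\<in>S. g j ` cball 0 \<rho>)"
    using assms
    by (intro bounded_UN ballI compact_imp_bounded compact_continuous_image)
       (auto intro: continuous_on_subset)
  then obtain M where "\<And>j w. j \<in> S \<Longrightarrow> w \<in> cball 0 \<rho> \<Longrightarrow> cmod (g j w) \<le> M"
    unfolding bounded_iff by blast
  thus ?thesis using that[of "max 0 M"] by (auto simp: le_max_iff_disj)
qed

lemma finite_family_equicontinuous:
  fixes g :: "'i \<Rightarrow> 'a::euclidean_space \<Rightarrow> complex"
  assumes S: "finite S" and g: "\<And>j. j \<in> S \<Longrightarrow> continuous_on UNIV (g j)" and e: "0 < e"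
  obtains \<delta> where "0 < \<delta>" "\<delta> \<le> 1"
    "\<And>j (w::'a) w'. j \<in> S \<Longrightarrow> w \<in> ball 0 \<rho> \<Longrightarrow> w' \<in> ball 0 \<rho> \<Longrightarrow> norm (w - w') \<le> \<delta>
       \<Longrightarrow> cmod (g j w - g j w') \<le> e"
proof -
  have "\<forall>\<^sub>F \<delta> in at_right 0. \<forall>j\<in>S. \<forall>w\<in>cball 0 \<rho>. \<forall>w'\<in>cball 0 \<rho>.
          norm (w - w') \<le> \<delta> \<longrightarrow> cmod (g j w - g j w') \<le> e"
  proof (rule eventually_ball_finite[OF S], rule ballI)
    fix j assume j: "j \<in> S"
    have "uniformly_continuous_on (cball 0 \<rho>) (g j)"
      using g[OF j] by (intro compact_uniformly_continuous) (auto intro: continuous_on_subset)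
    then obtain d where d: "0 < d" "\<And>w w'. w \<in> cball 0 \<rho> \<Longrightarrow> w' \<in> cball 0 \<rho> \<Longrightarrow> dist w w' < d
        \<Longrightarrow> dist (g j w) (g j w') < e"
      using e unfolding uniformly_continuous_on_def by metis
    show "\<forall>\<^sub>F \<delta> in at_right 0. \<forall>w\<in>cball 0 \<rho>. \<forall>w'\<in>cball 0 \<rho>.
          norm (w - w') \<le> \<delta> \<longrightarrow> cmod (g j w - g j w') \<le> e"
      unfolding eventually_at_right_field
    proof (intro exI[of _ d] conjI allI impI ballI d(1))
      fix y and w w' :: 'a assume "w \<in> cball 0 \<rho>" "w' \<in> cball 0 \<rho>" "y < d" "norm (w - w') \<le> y"
      thus "cmod (g j w - g j w') \<le> e" using d(2)[of w w'] by (simp add: dist_norm)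
    qed
  qed
  then obtain b where b: "0 < b" "\<And>\<delta>. 0 < \<delta> \<Longrightarrow> \<delta> < b \<Longrightarrow> \<forall>j\<in>S. \<forall>w\<in>cball 0 \<rho>. \<forall>w'\<in>cball 0 \<rho>.
          norm (w - w') \<le> \<delta> \<longrightarrow> cmod (g j w - g j w') \<le> e"
    unfolding eventually_at_right_field by blast
  show ?thesis
    by (rule that[of "min 1 (b / 2)"]) (use b(1) b(2)[of "min 1 (b / 2)"] in auto)
qed

text \<open>Around \<open>z\<close>, a function of the shift-invariant space is a combination of finitely many fixed
  functions \<open>g j\<close> with coefficients of total size at most a constant times the local mass. Thus it
  inherits the bounds and the modulus of continuity of the \<open>g j\<close>. Balls of radius \<open>D + 2\<close> around
  lattice points are used because every \<open>z\<close> has a lattice point within distance \<open>D\<close>, and the ball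
  of radius 1 around \<open>z\<close> is to be covered as well.\<close>

lemma shift_comb_local_estimates:
  fixes \<Phi> :: "nat \<Rightarrow> 'n::finite point \<Rightarrow> complex"
  assumes \<Phi>: "\<And>i. i \<in> {1..r} \<Longrightarrow> compact (supp (\<Phi> i))"
    and cont: "\<And>i. i \<in> {1..r} \<Longrightarrow> continuous_on UNIV (\<Phi> i)"
  obtains \<rho> C where "0 \<le> C"
    "\<And>c z z1. norm (z1 - z) \<le> 1 \<Longrightarrow>
       ennreal (cmod (shift_comb r \<Phi> c z1)) \<le> ennreal C * local_mass \<rho> (shift_comb r \<Phi> c) z"
    "\<And>e. 0 < e \<Longrightarrow> \<exists>\<delta>>0. \<delta> \<le> 1 \<and> (\<forall>c z z1 z2. norm (z1 - z) \<le> 1 \<longrightarrow> norm (z2 - z) \<le> 1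
       \<longrightarrow> norm (z1 - z2) \<le> \<delta> \<longrightarrow> ennreal (cmod (shift_comb r \<Phi> c z1 - shift_comb r \<Phi> c z2))
         \<le> ennreal e * local_mass \<rho> (shift_comb r \<Phi> c) z)"
proof -
  define D where "D = 1 + real CARD('n)"
  define \<rho>0 where "\<rho>0 = D + 2"
  define \<rho> where "\<rho> = \<rho>0 + D"
  obtain K where finK: "finite K" and
    K: "\<And>c m z. norm z < \<rho>0 \<Longrightarrow> shift_comb r \<Phi> c (z + lattice_pt m)
       = (\<Sum>(i, k)\<in>{1..r} \<times> K. c i (k + m) * \<Phi> i (z - lattice_pt k))"
    by (rule shift_comb_locally_finite[where \<rho> = \<rho>0 and r = r and \<Phi> = \<Phi>])
       (erule \<Phi>, rule that)
  define S where "S = {1..r} \<times> K"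
  define g where "g j z = \<Phi> (fst j) (z - lattice_pt (snd j))" for j z
  have S: "finite S" unfolding S_def using finK by simp
  have gc: "continuous_on UNIV (g j)" if "j \<in> S" for j
    using that unfolding g_def S_def
    by (intro continuous_on_compose2[OF cont] continuous_intros) auto
  obtain C0 where C0: "0 \<le> C0"
    "\<And>c. \<exists>d. (\<forall>z\<in>ball 0 \<rho>0. (\<Sum>j\<in>S. c j * g j z) = (\<Sum>j\<in>S. d j * g j z)) \<and>
       ennreal (\<Sum>j\<in>S. cmod (d j))
         \<le> ennreal C0 * (\<integral>\<^sup>+ z. indicator (ball 0 \<rho>0) z * ennreal (cmod (\<Sum>j\<in>S. c j * g j z)) \<partial>lborel)"
    by (rule span_coefficient_bound[where \<rho> = \<rho>0 and g = g, OF S]) (erule gc, rule that)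
  have rep: "\<exists>m d. norm (z - lattice_pt m) \<le> D \<and>
      (\<forall>w\<in>ball 0 \<rho>0. shift_comb r \<Phi> c (w + lattice_pt m) = (\<Sum>j\<in>S. d j * g j w)) \<and>
      ennreal (\<Sum>j\<in>S. cmod (d j)) \<le> ennreal C0 * local_mass \<rho> (shift_comb r \<Phi> c) z" for c z
  proof -
    define f where "f = shift_comb r \<Phi> c"
    have fc: "continuous_on UNIV f"
      unfolding f_def by (intro continuous_shift_comb \<Phi> cont)
    obtain m where m: "norm (z - lattice_pt m) \<le> D"
      using lattice_pt_near[of z] unfolding D_def by blast
    define t where "t = z - lattice_pt m"
    have fK: "f (w + lattice_pt m) = (\<Sum>j\<in>S. c (fst j) (snd j + m) * g j w)" if "w \<in> ball 0 \<rho>0" for w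
      using K[of w c m] that by (simp add: f_def S_def g_def split_beta')
    obtain d where d: "\<And>w. w \<in> ball 0 \<rho>0 \<Longrightarrow> (\<Sum>j\<in>S. c (fst j) (snd j + m) * g j w) = (\<Sum>j\<in>S. d j * g j w)"
      and dle: "ennreal (\<Sum>j\<in>S. cmod (d j)) \<le> ennreal C0 *
        (\<integral>\<^sup>+ w. indicator (ball 0 \<rho>0) w * ennreal (cmod (\<Sum>j\<in>S. c (fst j) (snd j + m) * g j w)) \<partial>lborel)"
      using C0(2)[of "\<lambda>j. c (fst j) (snd j + m)"] by blast
    have "(\<integral>\<^sup>+ w. indicator (ball 0 \<rho>0) w * ennreal (cmod (\<Sum>j\<in>S. c (fst j) (snd j + m) * g j w)) \<partial>lborel)
        = (\<integral>\<^sup>+ w. indicator (ball 0 \<rho>0) w * ennreal (cmod (f (w + lattice_pt m))) \<partial>lborel)"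
      by (intro nn_integral_cong) (auto simp: indicator_def fK)
    also have "\<dots> = (\<integral>\<^sup>+ h. indicator (ball 0 \<rho>0) (h + t) * ennreal (cmod (f (h + t + lattice_pt m))) \<partial>lborel)"
      by (intro nn_integral_lborel_translate[symmetric] borel_measurable_times_ennreal
          borel_measurable_indicator borel_open open_ball measurable_ennreal[THEN measurable_compose[rotated]]
          borel_measurable_continuous_onI continuous_intros continuous_on_compose2[OF fc]) auto
    also have "\<dots> \<le> local_mass \<rho> f z"
      unfolding local_mass_def
    proof (intro nn_integral_mono)
      fix h :: "'n point"
      have "norm h \<le> \<rho>" if "norm (h + t) < \<rho>0"
        using norm_triangle_ineq4[of "h + t" t] that m by (simp add: \<rho>_def t_def)
      thus "indicator (ball 0 \<rho>0) (h + t) * ennreal (cmod (f (h + t + lattice_pt m)))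
          \<le> indicator (cball 0 \<rho>) h * ennreal (cmod (f (z + h)))"
        by (auto simp: indicator_def t_def add.commute)
    qed
    finally have "ennreal (\<Sum>j\<in>S. cmod (d j)) \<le> ennreal C0 * local_mass \<rho> f z"
      using dle by (meson mult_left_mono order_trans zero_le)
    moreover have "\<forall>w\<in>ball 0 \<rho>0. f (w + lattice_pt m) = (\<Sum>j\<in>S. d j * g j w)"
      using fK d by simp
    ultimately show ?thesis using m unfolding f_def by blast
  qed
  have near: "z1 - lattice_pt m \<in> ball 0 \<rho>0" if "norm (z - lattice_pt m) \<le> D" "norm (z1 - z) \<le> 1" for z z1 m
    using norm_triangle_ineq[of "z1 - z" "z - lattice_pt m"] that by (simp add: \<rho>0_def)
  obtain M where M: "0 \<le> M" "\<And>j w. j \<in> S \<Longrightarrow> w \<in> ball 0 \<rho>0 \<Longrightarrow> cmod (g j w) \<le> M"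
    by (rule finite_family_bounded[where \<rho> = \<rho>0 and g = g, OF S]) (erule gc, rule that)
  have transfer: "ennreal (cmod (\<Sum>j\<in>S. d j * a j)) \<le> ennreal (b * C0) * I"
    if "ennreal (\<Sum>j\<in>S. cmod (d j)) \<le> ennreal C0 * I" "0 \<le> b" "\<And>j. j \<in> S \<Longrightarrow> cmod (a j) \<le> b" for d a b I
  proof -
    have "cmod (\<Sum>j\<in>S. d j * a j) \<le> (\<Sum>j\<in>S. b * cmod (d j))"
      using that(2,3) by (intro order_trans[OF norm_sum sum_mono]) (simp add: norm_mult mult_mono mult.commute[of b])
    also have "\<dots> = b * (\<Sum>j\<in>S. cmod (d j))" by (simp add: sum_distrib_left)
    finally have "ennreal (cmod (\<Sum>j\<in>S. d j * a j)) \<le> ennreal b * ennreal (\<Sum>j\<in>S. cmod (d j))"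
      using that(2) by (simp add: ennreal_leI flip: ennreal_mult')
    also have "\<dots> \<le> ennreal b * (ennreal C0 * I)"
      by (intro mult_left_mono that(1)) simp
    finally show ?thesis using that(2) C0(1) by (simp add: ennreal_mult mult.assoc)
  qed
  show ?thesis
  proof (rule that[of "M * C0" \<rho>])
    show "0 \<le> M * C0" using M(1) C0(1) by simp
  next
    fix c and z z1 :: "'n point" assume z1: "norm (z1 - z) \<le> 1"
    from rep[of z c] obtain m d where m: "norm (z - lattice_pt m) \<le> D"
      and d: "\<And>w. w \<in> ball 0 \<rho>0 \<Longrightarrow> shift_comb r \<Phi> c (w + lattice_pt m) = (\<Sum>j\<in>S. d j * g j w)"
      and le: "ennreal (\<Sum>j\<in>S. cmod (d j)) \<le> ennreal C0 * local_mass \<rho> (shift_comb r \<Phi> c) z" by blast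
    show "ennreal (cmod (shift_comb r \<Phi> c z1)) \<le> ennreal (M * C0) * local_mass \<rho> (shift_comb r \<Phi> c) z"
      using transfer[OF le M(1), of "\<lambda>j. g j (z1 - lattice_pt m)"] M(2) near[OF m z1] d[OF near[OF m z1]]
      by simp
  next
    fix e :: real assume e: "0 < e"
    \<comment> \<open>\<open>C0\<close> may be 0.\<close>
    define e' where "e' = e / (C0 + 1)"
    have e': "0 < e'" "e' * C0 \<le> e" using e C0(1) by (auto simp: e'_def field_simps)
    obtain \<delta> where \<delta>: "0 < \<delta>" "\<delta> \<le> 1"
      "\<And>j w w'. j \<in> S \<Longrightarrow> w \<in> ball 0 \<rho>0 \<Longrightarrow> w' \<in> ball 0 \<rho>0 \<Longrightarrow> norm (w - w') \<le> \<delta>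
         \<Longrightarrow> cmod (g j w - g j w') \<le> e'"
      by (rule finite_family_equicontinuous[where \<rho> = \<rho>0 and g = g, OF S _ e'(1)]) (erule gc, rule that)
    have "ennreal (cmod (shift_comb r \<Phi> c z1 - shift_comb r \<Phi> c z2))
         \<le> ennreal e * local_mass \<rho> (shift_comb r \<Phi> c) z"
      if z1: "norm (z1 - z) \<le> 1" and z2: "norm (z2 - z) \<le> 1" and z12: "norm (z1 - z2) \<le> \<delta>" for c z z1 z2
    proof -
      from rep[of z c] obtain m d where m: "norm (z - lattice_pt m) \<le> D"
        and d: "\<And>w. w \<in> ball 0 \<rho>0 \<Longrightarrow> shift_comb r \<Phi> c (w + lattice_pt m) = (\<Sum>j\<in>S. d j * g j w)"
        and le: "ennreal (\<Sum>j\<in>S. cmod (d j)) \<le> ennreal C0 * local_mass \<rho> (shift_comb r \<Phi> c) z" by blast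
      have "ennreal (cmod (\<Sum>j\<in>S. d j * (g j (z1 - lattice_pt m) - g j (z2 - lattice_pt m))))
          \<le> ennreal (e' * C0) * local_mass \<rho> (shift_comb r \<Phi> c) z"
        using e' z12 by (intro transfer[OF le] \<delta>(3) near[OF m] z1 z2) auto
      also have "(\<Sum>j\<in>S. d j * (g j (z1 - lattice_pt m) - g j (z2 - lattice_pt m)))
          = shift_comb r \<Phi> c z1 - shift_comb r \<Phi> c z2"
        using d[OF near[OF m z1]] d[OF near[OF m z2]] by (simp add: algebra_simps sum_subtractf)
      also have "ennreal (e' * C0) * local_mass \<rho> (shift_comb r \<Phi> c) z
          \<le> ennreal e * local_mass \<rho> (shift_comb r \<Phi> c) z"
        using e'(2) by (intro mult_right_mono ennreal_leI) auto
      finally show ?thesis .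
    qed
    thus "\<exists>\<delta>>0. \<delta> \<le> 1 \<and> (\<forall>c z z1 z2. norm (z1 - z) \<le> 1 \<longrightarrow> norm (z2 - z) \<le> 1
       \<longrightarrow> norm (z1 - z2) \<le> \<delta> \<longrightarrow> ennreal (cmod (shift_comb r \<Phi> c z1 - shift_comb r \<Phi> c z2))
         \<le> ennreal e * local_mass \<rho> (shift_comb r \<Phi> c) z)"
      using \<delta>(1,2) by blast
  qed
qed

section \<open>The sampling operator is close to the identity\<close>

text \<open>Both sides are 0 if the family is not summable, so the equation holds unconditionally, and
  measurability of parametrised sums follows from that of parametrised integrals.\<close>

lemma infsum_eq_integral_count_space:
  fixes f :: "'a \<Rightarrow> complex"
  shows "infsum f A = (\<integral>k. f k \<partial>count_space A)"
proof (cases "f summable_on A")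
  case True
  hence "Infinite_Sum.abs_summable_on f A" by (simp add: summable_on_iff_abs_summable_on_complex)
  hence "infsetsum f A = infsum f A"
    by (intro infsetsum_infsum) (simp add: abs_summable_equivalent)
  thus ?thesis by (simp add: infsetsum_def)
next
  case False
  hence "\<not> Infinite_Sum.abs_summable_on f A" by (simp add: summable_on_iff_abs_summable_on_complex)
  hence "infsetsum f A = 0"
    by (intro not_summable_infsetsum_eq) (simp add: abs_summable_equivalent)
  thus ?thesis using False by (simp add: infsum_not_exists infsetsum_def)
qed

lemma measurable_avg_op:
  assumes J: "countable J" and \<beta>: "bupu \<gamma> J x y \<beta>"
  shows "avg_op \<psi> a J x y \<beta> f \<in> borel_measurable lebesgue"
proof -
  define h where "h z jk = avg_sample \<psi> a f (x (fst jk), y (snd jk)) * complex_of_real (\<beta> (fst jk) (snd jk) z)"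
    for z jk
  have JJ: "countable (J \<times> J)" using J by simp
  have "(\<lambda>z. h z jk) \<in> borel_measurable lebesgue" if "jk \<in> J \<times> J" for jk
  proof -
    have [measurable]: "\<beta> (fst jk) (snd jk) \<in> borel_measurable lebesgue"
      using \<beta> that by (auto simp: bupu_def)
    show ?thesis unfolding h_def by measurable
  qed
  hence "(\<lambda>(jk, z). h z jk) \<in> borel_measurable (count_space (J \<times> J) \<Otimes>\<^sub>M lebesgue)"
    by (intro measurable_pair_measure_countable1 JJ) auto
  hence "case_prod h \<in> borel_measurable (lebesgue \<Otimes>\<^sub>M count_space (J \<times> J))"
    by (subst measurable_pair_swap_iff) (simp add: split_beta')
  hence "(\<lambda>z. \<integral>jk. h z jk \<partial>count_space (J \<times> J)) \<in> borel_measurable lebesgue"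
    by (rule sigma_finite_measure.borel_measurable_lebesgue_integral
          [OF sigma_finite_measure_count_space_countable[OF JJ]])
  moreover have "avg_op \<psi> a J x y \<beta> f = (\<lambda>z. \<integral>jk. h z jk \<partial>count_space (J \<times> J))"
    by (simp add: fun_eq_iff avg_op_def h_def split_beta' flip: infsum_eq_integral_count_space)
  ultimately show ?thesis by simp
qed

text \<open>The \<open>\<beta> j k z\<close> are weights of total mass 1, carried by those grid points whose ball contains \<open>z\<close>:
  a weighted mean of values that are all within \<open>e\<close> of \<open>v\<close> is within \<open>e\<close> of \<open>v\<close>.\<close>

lemma bupu_average_error:
  assumes \<beta>: "bupu \<gamma> J x y \<beta>"
    and s: "\<And>j k. j \<in> J \<Longrightarrow> k \<in> J \<Longrightarrow> norm (z - (x j, y k)) < \<gamma> \<Longrightarrow> ennreal (cmod (v - s j k)) \<le> e"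
  shows "ennreal (cmod (v - (\<Sum>\<^sub>\<infinity>(j, k)\<in>J \<times> J. s j k * complex_of_real (\<beta> j k z)))) \<le> e"
proof (cases e)
  case (real E)
  define b where "b jk = \<beta> (fst jk) (snd jk) z" for jk
  define t where "t jk = s (fst jk) (snd jk)" for jk
  have b: "(b has_sum 1) (J \<times> J)"
    using \<beta> unfolding bupu_def b_def split_beta' by blast
  have bound: "norm ((v - t jk) * of_real (b jk)) \<le> E * b jk" if jk: "jk \<in> J \<times> J" for jk
  proof -
    have b01: "0 \<le> b jk"
      using \<beta> jk unfolding bupu_def b_def mem_Times_iff by blast
    show ?thesis
    proof (cases "b jk = 0")
      case False
      hence "z \<in> supp (\<beta> (fst jk) (snd jk))"
        by (auto simp: supp_def b_def intro: closure_subset[THEN subsetD])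
      hence "z \<in> ball (x (fst jk), y (snd jk)) \<gamma>"
        using \<beta> jk unfolding bupu_def mem_Times_iff by blast
      hence "norm (z - (x (fst jk), y (snd jk))) < \<gamma>" by (simp add: dist_norm norm_minus_commute)
      hence "cmod (v - t jk) \<le> E"
        using s[of "fst jk" "snd jk"] jk real by (auto simp: t_def)
      thus ?thesis using b01 by (simp add: norm_mult mult_right_mono)
    qed simp
  qed
  have Eb: "((\<lambda>jk. E * b jk) has_sum E) (J \<times> J)"
    using has_sum_cmult_right[OF b, of E] by simp
  have "Infinite_Sum.abs_summable_on (\<lambda>jk. (v - t jk) * of_real (b jk)) (J \<times> J)"
    using Eb bound by (intro Infinite_Sum.abs_summable_on_comparison_test') (auto simp: summable_on_def)
  hence "(\<lambda>jk. (v - t jk) * of_real (b jk)) summable_on J \<times> J"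
    by (rule abs_summable_summable)
  then obtain S where S: "((\<lambda>jk. (v - t jk) * of_real (b jk)) has_sum S) (J \<times> J)"
    by (auto simp: summable_on_def)
  have "((\<lambda>jk. v * complex_of_real (b jk)) has_sum v) (J \<times> J)"
    using has_sum_cmult_right[OF has_sum_of_real[OF b], of v] by simp
  from has_sum_add[OF this has_sum_cmult_right[OF S, of "-1"]] have "((\<lambda>jk. t jk * of_real (b jk)) has_sum (v - S)) (J \<times> J)"
    by (simp add: algebra_simps)
  hence "v - (\<Sum>\<^sub>\<infinity>(j, k)\<in>J \<times> J. s j k * complex_of_real (\<beta> j k z)) = S"
    by (simp add: infsumI t_def b_def split_beta')
  moreover have "norm S \<le> E"
    using norm_infsum_le[OF S Eb bound] .
  ultimately show ?thesis using real by (simp add: ennreal_leI)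
qed simp

lemma avg_sample_eq:
  fixes f \<psi> :: "'n::finite point \<Rightarrow> complex"
  assumes f: "continuous_on UNIV f" and \<psi>: "continuous_on UNIV \<psi>" and a: "0 < a"
  shows "avg_sample \<psi> a f w = (LINT u|lborel. f (w + a *\<^sub>R u) * cnj (\<psi> u))"
proof -
  define h where "h z = f z * cnj (dilate a \<psi> (z - w))" for z
  have hc: "continuous_on UNIV h"
    unfolding h_def dilate_def
    by (intro continuous_intros continuous_on_compose2[OF f] continuous_on_compose2[OF \<psi>]) auto
  have [measurable]: "h \<in> borel_measurable borel"
    by (rule borel_measurable_continuous_onI[OF hc])
  have [measurable]: "(\<lambda>u. h (w + a *\<^sub>R u)) \<in> borel_measurable borel"
    by (intro borel_measurable_continuous_onI continuous_intros continuous_on_compose2[OF hc]) auto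
  have [measurable]: "(\<lambda>u. w + a *\<^sub>R u) \<in> borel_measurable borel"
    by (intro borel_measurable_continuous_onI continuous_intros)
  have "avg_sample \<psi> a f w = (LINT z|lborel. h z)"
    unfolding avg_sample_def pairing_def h_def[symmetric] by (rule integral_completion) simp
  also have "\<dots> = (LINT z|density (distr lborel borel (\<lambda>x. w + a *\<^sub>R x)) (\<lambda>_. ennreal (\<bar>a\<bar>^DIM('n point))). h z)"
    using a by (subst lborel_affine[of a w]) auto
  also have "\<dots> = (LINT z|distr lborel borel (\<lambda>x. w + a *\<^sub>R x). \<bar>a\<bar>^DIM('n point) *\<^sub>R h z)"
    by (rule integral_density) auto
  also have "\<dots> = (LINT u|lborel. \<bar>a\<bar>^DIM('n point) *\<^sub>R h (w + a *\<^sub>R u))"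
    by (rule integral_distr) auto
  also have "\<dots> = (LINT u|lborel. f (w + a *\<^sub>R u) * cnj (\<psi> u))"
    using a by (intro Bochner_Integration.integral_cong) (auto simp: h_def dilate_def field_simps scaleR_conv_of_real)
  finally show ?thesis .
qed

text \<open>As \<open>\<psi>\<close> has integral 1, \<open>v\<close> is its own average, and the difference can be taken under the
  integral. When the right-hand side is finite, that integrand is integrable, and so is the
  one that defines the sample.\<close>

lemma avg_sample_error:
  fixes f \<psi> :: "'n::finite point \<Rightarrow> complex"
  assumes f: "continuous_on UNIV f" and \<psi>: "continuous_on UNIV \<psi>" and a: "0 < a"
    and int: "integrable lborel \<psi>" and one: "(LINT u|lborel. \<psi> u) = 1"
  shows "ennreal (cmod (v - avg_sample \<psi> a f w))
    \<le> (\<integral>\<^sup>+ u. ennreal (cmod (v - f (w + a *\<^sub>R u))) * ennreal (cmod (\<psi> u)) \<partial>lborel)" (is "_ \<le> ?I")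
proof (cases "?I = \<infinity>")
  case False
  define g where "g u = (v - f (w + a *\<^sub>R u)) * cnj (\<psi> u)" for u
  have [measurable]: "g \<in> borel_measurable borel"
    unfolding g_def
    by (intro borel_measurable_continuous_onI continuous_intros continuous_on_compose2[OF f] \<psi>) auto
  have norm_g: "(\<integral>\<^sup>+ u. ennreal (norm (g u)) \<partial>lborel) = ?I"
    by (simp add: g_def norm_mult ennreal_mult)
  have g: "integrable lborel g"
    using False norm_g by (intro integrableI_bounded) (auto simp: less_top)
  have v: "integrable lborel (\<lambda>u. v * cnj (\<psi> u))" using int by simp
  have "(LINT u|lborel. v * cnj (\<psi> u)) = v"
    by (simp add: one)
  moreover have "avg_sample \<psi> a f w = (LINT u|lborel. v * cnj (\<psi> u) - g u)"
    unfolding avg_sample_eq[OF f \<psi> a] by (simp add: g_def algebra_simps)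
  ultimately have "v - avg_sample \<psi> a f w = (LINT u|lborel. g u)"
    using v g by simp
  thus ?thesis
    using integral_norm_bound_ennreal[OF g] norm_g by simp
qed simp

lemma mixed_norm_weighted_translates:
  fixes F :: "'a::euclidean_space \<times> 'b::euclidean_space \<Rightarrow> ennreal"
  assumes p: "1 \<le> p" and q: "1 \<le> q"
    and [measurable]: "F \<in> borel_measurable borel" "\<tau> \<in> borel_measurable M" "K \<in> borel_measurable M"
    and K: "(\<integral>\<^sup>+ v. K v \<partial>M) < \<infinity>"
  shows "mixed_norm p q (\<lambda>z. \<integral>\<^sup>+ v. K v * F (z + \<tau> v) \<partial>M) \<le> (\<integral>\<^sup>+ v. K v \<partial>M) * mixed_norm p q F"
proof -
  define L where "L = density M K"
  have mass: "emeasure L (space L) = (\<integral>\<^sup>+ v. K v \<partial>M)"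
    by (simp add: L_def emeasure_density)
  have "finite_measure L" using K by (intro finite_measureI) (simp add: mass)
  hence L: "sigma_finite_measure L" by (simp add: finite_measure_def)
  have "mixed_norm p q (\<lambda>z. \<integral>\<^sup>+ v. F (z + \<tau> v) \<partial>L) \<le> emeasure L (space L) * mixed_norm p q F"
    by (rule mixed_norm_average_of_translates[OF p q L]) (auto simp: L_def)
  thus ?thesis unfolding mass by (simp add: L_def nn_integral_density)
qed

lemma nn_integral_tail_tendsto_0:
  fixes \<psi> :: "'a::euclidean_space \<Rightarrow> complex"
  assumes "integrable lborel \<psi>" and e: "0 < e"
  obtains R :: real where "0 < R"
    "(\<integral>\<^sup>+ u. indicator (- cball 0 R) u * ennreal (cmod (\<psi> u)) \<partial>lborel) \<le> ennreal e"
proof -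
  have [measurable]: "\<psi> \<in> borel_measurable borel" using assms(1) by auto
  have cb [measurable]: "- cball 0 R \<in> sets (borel :: 'a measure)" for R by auto
  have "(\<lambda>n. \<integral>\<^sup>+ u. indicator (- cball 0 (real n)) u * ennreal (cmod (\<psi> u)) \<partial>lborel)
      \<longlonglongrightarrow> (\<integral>\<^sup>+ u. 0 \<partial>(lborel :: 'a measure))"
  proof (rule nn_integral_dominated_convergence[where w = "\<lambda>u. ennreal (cmod (\<psi> u))"])
    show "(\<integral>\<^sup>+ u. ennreal (cmod (\<psi> u)) \<partial>lborel) < \<infinity>"
      using assms(1) by (simp add: integrable_iff_bounded)
    show "AE u in lborel. (\<lambda>n. indicator (- cball 0 (real n)) u * ennreal (cmod (\<psi> u))) \<longlonglongrightarrow> 0"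
    proof (rule AE_I2)
      fix u :: 'a
      obtain N where N: "norm u \<le> real N" using real_arch_simple by blast
      have "\<forall>\<^sub>F n in sequentially. indicator (- cball 0 (real n)) u * ennreal (cmod (\<psi> u)) = 0"
        using eventually_ge_at_top[of N] by eventually_elim (use N in \<open>auto simp: indicator_def\<close>)
      thus "(\<lambda>n. indicator (- cball 0 (real n)) u * ennreal (cmod (\<psi> u))) \<longlonglongrightarrow> 0"
        by (rule tendsto_eventually)
    qed
  qed (auto simp: indicator_def)
  hence "\<forall>\<^sub>F n in sequentially.
      (\<integral>\<^sup>+ u. indicator (- cball 0 (real n)) u * ennreal (cmod (\<psi> u)) \<partial>lborel) < ennreal e"
    using e by (intro order_tendstoD(2)) auto
  with eventually_gt_at_top[of 0] have "\<forall>\<^sub>F n in sequentially. 0 < n \<and>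
      (\<integral>\<^sup>+ u. indicator (- cball 0 (real n)) u * ennreal (cmod (\<psi> u)) \<partial>lborel) < ennreal e"
    by eventually_elim auto
  then obtain n where "0 < n"
      "(\<integral>\<^sup>+ u. indicator (- cball 0 (real n)) u * ennreal (cmod (\<psi> u)) \<partial>lborel) < ennreal e"
    by (auto dest: eventually_happens)
  thus ?thesis using that[of "real n"] by simp
qed


text \<open>The error at \<open>z\<close> is at most \<open>(e \<Psi> + C t) G z + C Tail z\<close>: here \<open>e\<close> bounds the oscillation at
  scale \<open>d\<close>, \<open>\<Psi>\<close> is the integral of \<open>\<bar>\<psi>\<bar>\<close> and \<open>t\<close> bounds the integral of \<open>\<bar>\<psi>\<bar>\<close> over the complement
  of the ball of radius \<open>R\<close>, while \<open>C\<close> is the constant of the size estimate. Both \<open>G\<close> and \<open>Tail\<close> are averages of translates of \<open>\<bar>f\<bar>\<close>. The radius \<open>R\<close> is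
  fixed first, by \<open>t\<close>; the conditions \<open>\<gamma> \<le> d / 2\<close> and \<open>a R \<le> d / 2\<close> then keep \<open>w + a u\<close> within
  distance \<open>d\<close> of \<open>z\<close> for \<open>\<bar>u\<bar> \<le> R\<close>.\<close>

lemma averaging_near_identity:
  fixes \<Phi> :: "nat \<Rightarrow> 'n::finite point \<Rightarrow> complex" and \<psi> :: "'n point \<Rightarrow> complex"
  assumes p: "1 \<le> p" and q: "1 \<le> q"
    and \<Phi>: "\<And>i. i \<in> {1..r} \<Longrightarrow> compact (supp (\<Phi> i))"
    and cont: "\<And>i. i \<in> {1..r} \<Longrightarrow> continuous_on UNIV (\<Phi> i)"
    and \<psi>: "continuous_on UNIV \<psi>" and int: "integrable lborel \<psi>" and one: "(LINT u|lborel. \<psi> u) = 1"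
    and \<kappa>: "0 < \<kappa>"
  obtains \<delta> where "0 < \<delta>"
    "\<And>\<gamma> a J (x :: 'j \<Rightarrow> real) y \<beta> c. \<gamma> \<le> \<delta> \<Longrightarrow> 0 < a \<Longrightarrow> a \<le> \<delta> \<Longrightarrow> bupu \<gamma> J x y \<beta> \<Longrightarrow>
       Lpq_norm p q (\<lambda>z. shift_comb r \<Phi> c z - avg_op \<psi> a J x y \<beta> (shift_comb r \<Phi> c) z)
         \<le> ennreal \<kappa> * Lpq_norm p q (shift_comb r \<Phi> c)"
proof -
  obtain \<rho> C where C: "0 \<le> C"
    and size: "\<And>c z z1. norm (z1 - z) \<le> 1 \<Longrightarrow>
       ennreal (cmod (shift_comb r \<Phi> c z1)) \<le> ennreal C * local_mass \<rho> (shift_comb r \<Phi> c) z"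
    and osc: "\<And>e. 0 < e \<Longrightarrow> \<exists>\<delta>>0. \<delta> \<le> 1 \<and> (\<forall>c z z1 z2. norm (z1 - z) \<le> 1 \<longrightarrow> norm (z2 - z) \<le> 1
       \<longrightarrow> norm (z1 - z2) \<le> \<delta> \<longrightarrow> ennreal (cmod (shift_comb r \<Phi> c z1 - shift_comb r \<Phi> c z2))
         \<le> ennreal e * local_mass \<rho> (shift_comb r \<Phi> c) z)"
    by (rule shift_comb_local_estimates[where r = r and \<Phi> = \<Phi>]) (erule \<Phi>, erule cont, rule that)
  define \<Psi> where "\<Psi> = (LINT u|lborel. cmod (\<psi> u))"
  have \<Psi>: "(\<integral>\<^sup>+ u. ennreal (cmod (\<psi> u)) \<partial>lborel) = ennreal \<Psi>" "0 \<le> \<Psi>"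
    using int by (auto simp: \<Psi>_def nn_integral_eq_integral)
  have cball_m [measurable]: "cball (0 :: 'n point) s \<in> sets borel" "- cball (0 :: 'n point) s \<in> sets borel" for s
    by auto
  define vol where "vol = measure lborel (cball (0 :: 'n point) \<rho>)"
  have "emeasure lborel (cball (0 :: 'n point) \<rho>) < \<infinity>"
    by (rule emeasure_bounded_finite) simp
  hence vol: "(\<integral>\<^sup>+ h. indicator (cball 0 \<rho>) h \<partial>(lborel :: 'n point measure)) = ennreal vol" "0 \<le> vol"
    by (auto simp: vol_def emeasure_eq_ennreal_measure)
  \<comment> \<open>The relative error will be at most \<open>(e * \<Psi> + 2 * C * t) * vol\<close>; adding 1 avoids division by 0.\<close>
  define e where "e = \<kappa> / (2 * (\<Psi> * vol + 1))"
  define t where "t = \<kappa> / (4 * (C * vol + 1))"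
  have e: "0 < e" "e * \<Psi> * vol \<le> \<kappa> / 2"
  proof -
    have "0 \<le> \<Psi> * vol" using \<Psi>(2) vol(2) by simp
    thus "0 < e" "e * \<Psi> * vol \<le> \<kappa> / 2"
      using \<kappa> by (auto simp: e_def field_simps)
  qed
  have t: "0 < t" "2 * (C * t * vol) \<le> \<kappa> / 2"
  proof -
    have "0 \<le> C * vol" using C vol(2) by simp
    thus "0 < t" "2 * (C * t * vol) \<le> \<kappa> / 2"
      using \<kappa> by (auto simp: t_def field_simps)
  qed
  obtain d where d: "0 < d" "d \<le> 1"
    and osc_d: "\<And>c z z1 z2. norm (z1 - z) \<le> 1 \<Longrightarrow> norm (z2 - z) \<le> 1
       \<Longrightarrow> norm (z1 - z2) \<le> d \<Longrightarrow> ennreal (cmod (shift_comb r \<Phi> c z1 - shift_comb r \<Phi> c z2))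
         \<le> ennreal e * local_mass \<rho> (shift_comb r \<Phi> c) z"
    using osc[OF e(1)] by blast
  obtain R where R: "0 < R"
    and tail: "(\<integral>\<^sup>+ u. indicator (- cball 0 R) u * ennreal (cmod (\<psi> u)) \<partial>lborel) \<le> ennreal t"
    by (rule nn_integral_tail_tendsto_0[OF int t(1)])
  define \<delta> where "\<delta> = min (d / 2) (d / (2 * R))"
  have \<delta>: "0 < \<delta>" "\<delta> \<le> d / 2" "\<delta> * R \<le> d / 2"
  proof -
    have "\<delta> * R \<le> d / (2 * R) * R" using R by (intro mult_right_mono) (auto simp: \<delta>_def)
    thus "0 < \<delta>" "\<delta> \<le> d / 2" "\<delta> * R \<le> d / 2" using d R by (auto simp: \<delta>_def)
  qed
  show ?thesis
  proof (rule that[OF \<delta>(1)])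
    fix \<gamma> a :: real and J and x :: "'j \<Rightarrow> real" and y :: "'j \<Rightarrow> real ^ 'n" and \<beta> c
    assume \<gamma>: "\<gamma> \<le> \<delta>" and a: "0 < a" "a \<le> \<delta>" and \<beta>: "bupu \<gamma> J x y \<beta>"
    define f where "f = shift_comb r \<Phi> c"
    define F where "F z = ennreal (cmod (f z))" for z
    define G where "G = local_mass \<rho> f"
    define Tail where "Tail z = (\<integral>\<^sup>+ u. indicator (- cball 0 R) u * ennreal (cmod (\<psi> u)) * G (z + a *\<^sub>R u) \<partial>lborel)" for z
    have fc: "continuous_on UNIV f"
      unfolding f_def by (intro continuous_shift_comb \<Phi> cont)
    have F [measurable]: "F \<in> borel_measurable borel"
      unfolding F_def
      by (intro measurable_compose[OF borel_measurable_continuous_onI measurable_ennreal] continuous_intros fc)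
    have [measurable]: "\<psi> \<in> borel_measurable borel"
      by (intro borel_measurable_continuous_onI \<psi>)
    have G_eq: "G = (\<lambda>z. \<integral>\<^sup>+ h. indicator (cball 0 \<rho>) h * F (z + h) \<partial>lborel)"
      by (simp add: fun_eq_iff G_def local_mass_def F_def)
    have G [measurable]: "G \<in> borel_measurable borel"
      unfolding G_eq by measurable
    have au [measurable]: "(\<lambda>u :: 'n point. a *\<^sub>R u) \<in> borel_measurable borel"
      by (intro borel_measurable_continuous_onI continuous_intros)
    have T [measurable]: "Tail \<in> borel_measurable borel"
      unfolding Tail_def by measurable
    have pt: "ennreal (cmod (f z - avg_op \<psi> a J x y \<beta> f z))
        \<le> ennreal (e * \<Psi> + C * t) * G z + ennreal C * Tail z" for z
      unfolding avg_op_def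
    proof (rule bupu_average_error[OF \<beta>])
      fix j k assume w': "norm (z - (x j, y k)) < \<gamma>"
      define w where "w = (x j, y k)"
      have w: "norm (z - w) \<le> d / 2" using w' \<gamma> \<delta>(2) by (simp add: w_def)
      have "ennreal (cmod (f z - avg_sample \<psi> a f w))
          \<le> (\<integral>\<^sup>+ u. ennreal (cmod (f z - f (w + a *\<^sub>R u))) * ennreal (cmod (\<psi> u)) \<partial>lborel)"
        by (rule avg_sample_error[OF fc \<psi> a(1) int one])
      also have "\<dots> \<le> (\<integral>\<^sup>+ u. (ennreal e * G z) * ennreal (cmod (\<psi> u))
            + (ennreal C * G z) * (indicator (- cball 0 R) u * ennreal (cmod (\<psi> u)))
            + ennreal C * (indicator (- cball 0 R) u * ennreal (cmod (\<psi> u)) * G (z + a *\<^sub>R u)) \<partial>lborel)"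
      proof (intro nn_integral_mono)
        fix u :: "'n point"
        have zw: "norm (w + a *\<^sub>R u - (z + a *\<^sub>R u)) \<le> d / 2"
          using w by (simp add: norm_minus_commute)
        show "ennreal (cmod (f z - f (w + a *\<^sub>R u))) * ennreal (cmod (\<psi> u))
          \<le> (ennreal e * G z) * ennreal (cmod (\<psi> u))
            + (ennreal C * G z) * (indicator (- cball 0 R) u * ennreal (cmod (\<psi> u)))
            + ennreal C * (indicator (- cball 0 R) u * ennreal (cmod (\<psi> u)) * G (z + a *\<^sub>R u))"
        proof (cases "norm u \<le> R")
          case True
          have "norm (a *\<^sub>R u) \<le> \<delta> * R"
            using True a R by (simp add: mult_mono)
          hence "norm (z - (w + a *\<^sub>R u)) \<le> d"
            using norm_triangle_ineq4[of "z - w" "a *\<^sub>R u"] w \<delta>(3) by (simp add: algebra_simps)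
          hence "ennreal (cmod (f z - f (w + a *\<^sub>R u))) \<le> ennreal e * G z"
            unfolding f_def G_def using d(2) by (intro osc_d) (auto simp: norm_minus_commute)
          hence "ennreal (cmod (f z - f (w + a *\<^sub>R u))) * ennreal (cmod (\<psi> u))
              \<le> (ennreal e * G z) * ennreal (cmod (\<psi> u))"
            by (intro mult_right_mono) auto
          thus ?thesis using True by (simp add: indicator_def)
        next
          case False
          have "ennreal (cmod (f z - f (w + a *\<^sub>R u)))
              \<le> ennreal (cmod (f z)) + ennreal (cmod (f (w + a *\<^sub>R u)))"
            by (simp add: norm_triangle_ineq4 flip: ennreal_plus)
          also have "\<dots> \<le> ennreal C * G z + ennreal C * G (z + a *\<^sub>R u)"
            unfolding f_def G_def using d(2) zw by (intro add_mono size) auto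
          finally have "ennreal (cmod (f z - f (w + a *\<^sub>R u))) * ennreal (cmod (\<psi> u))
              \<le> (ennreal C * G z + ennreal C * G (z + a *\<^sub>R u)) * ennreal (cmod (\<psi> u))"
            by (intro mult_right_mono) auto
          also have "\<dots> = (ennreal C * G z) * ennreal (cmod (\<psi> u)) + ennreal C * (ennreal (cmod (\<psi> u)) * G (z + a *\<^sub>R u))"
            by (simp add: distrib_left distrib_right mult_ac)
          also have "\<dots> \<le> (ennreal e * G z) * ennreal (cmod (\<psi> u)) + \<dots>"
            by (simp add: add_increasing)
          finally show ?thesis using False by (simp add: indicator_def add.assoc)
        qed
      qed
      also have "\<dots> = (ennreal e * G z) * ennreal \<Psi>
            + (ennreal C * G z) * (\<integral>\<^sup>+ u. indicator (- cball 0 R) u * ennreal (cmod (\<psi> u)) \<partial>lborel)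
            + ennreal C * Tail z"
        by (simp add: nn_integral_add nn_integral_cmult \<Psi>(1) Tail_def)
      also have "\<dots> \<le> (ennreal e * G z) * ennreal \<Psi> + (ennreal C * G z) * ennreal t + ennreal C * Tail z"
        by (intro add_mono mult_left_mono tail) auto
      also have "\<dots> = ennreal (e * \<Psi> + C * t) * G z + ennreal C * Tail z"
        using e(1) \<Psi>(2) C t(1) by (simp add: ennreal_mult distrib_left distrib_right mult_ac)
      finally show "ennreal (cmod (f z - avg_sample \<psi> a f (x j, y k)))
          \<le> ennreal (e * \<Psi> + C * t) * G z + ennreal C * Tail z"
        by (simp add: w_def)
    qed
    have p0: "0 < p" and q0: "0 < q" using p q by auto
    have normG: "mixed_norm p q G \<le> ennreal vol * mixed_norm p q F"
      unfolding G_eq using mixed_norm_weighted_translates[OF p q F, of "\<lambda>h. h" lborel "indicator (cball 0 \<rho>)"] vol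
      by simp
    have normT: "mixed_norm p q Tail \<le> ennreal t * mixed_norm p q G"
    proof -
      have "mixed_norm p q Tail
          \<le> (\<integral>\<^sup>+ u. indicator (- cball 0 R) u * ennreal (cmod (\<psi> u)) \<partial>lborel) * mixed_norm p q G"
        unfolding Tail_def using tail
        by (intro mixed_norm_weighted_translates[OF p q G]) (auto intro: le_less_trans)
      also have "\<dots> \<le> ennreal t * mixed_norm p q G"
        by (intro mult_right_mono tail) auto
      finally show ?thesis .
    qed
    have "Lpq_norm p q (\<lambda>z. f z - avg_op \<psi> a J x y \<beta> f z)
        \<le> mixed_norm p q (\<lambda>z. ennreal (e * \<Psi> + C * t) * G z + ennreal C * Tail z)"
      unfolding Lpq_norm_eq_mixed_norm by (intro mixed_norm_mono_AE p0 q0 AE_I2 pt)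
    also have "\<dots> \<le> mixed_norm p q (\<lambda>z. ennreal (e * \<Psi> + C * t) * G z) + mixed_norm p q (\<lambda>z. ennreal C * Tail z)"
      by (intro mixed_norm_add p q) measurable
    also have "\<dots> = ennreal (e * \<Psi> + C * t) * mixed_norm p q G + ennreal C * mixed_norm p q Tail"
      by (simp add: mixed_norm_cmult[OF p0 q0])
    also have "\<dots> \<le> ennreal (e * \<Psi> + C * t) * mixed_norm p q G + ennreal C * (ennreal t * mixed_norm p q G)"
      by (intro add_mono mult_left_mono normT) auto
    also have "\<dots> = ennreal (e * \<Psi> + 2 * (C * t)) * mixed_norm p q G"
      using e(1) \<Psi>(2) C t(1)
      by (simp add: ennreal_mult distrib_left distrib_right mult_2 mult_ac add.assoc)
    also have "\<dots> \<le> ennreal (e * \<Psi> + 2 * (C * t)) * (ennreal vol * mixed_norm p q F)"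
      by (intro mult_left_mono normG) auto
    also have "\<dots> = ennreal ((e * \<Psi> + 2 * (C * t)) * vol) * mixed_norm p q F"
      using e(1) \<Psi>(2) C t(1) vol(2) by (simp add: ennreal_mult mult_ac)
    also have "\<dots> \<le> ennreal \<kappa> * mixed_norm p q F"
      using e(2) t(2) by (intro mult_right_mono ennreal_leI) (auto simp: algebra_simps)
    also have "mixed_norm p q F = Lpq_norm p q f"
      unfolding Lpq_norm_eq_mixed_norm F_def ..
    finally show "Lpq_norm p q (\<lambda>z. shift_comb r \<Phi> c z - avg_op \<psi> a J x y \<beta> (shift_comb r \<Phi> c) z)
         \<le> ennreal \<kappa> * Lpq_norm p q (shift_comb r \<Phi> c)"
      by (simp add: f_def)
  qed
qed

section \<open>The iteration\<close>

lemma bounded_projectionD: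
  fixes U :: "('n::finite point \<Rightarrow> complex) set"
  assumes p: "1 \<le> p" and q: "1 \<le> q" and P: "bounded_projection_onto p q U P"
  shows bounded_projection_diff: "f \<in> Lpq p q \<Longrightarrow> g \<in> Lpq p q \<Longrightarrow>
      AE z in lebesgue. P (\<lambda>w. f w - g w) z = P f z - P g z"
    and bounded_projection_fixes: "f \<in> Lpq p q \<Longrightarrow> g \<in> U \<Longrightarrow> AE z in lebesgue. f z = g z \<Longrightarrow>
      AE z in lebesgue. P f z = f z"
proof -
  have p0: "0 < p" and q0: "0 < q" using p q by auto
  have add: "AE z in lebesgue. P (\<lambda>w. f w + g w) z = P f z + P g z"
    if "f \<in> Lpq p q" "g \<in> Lpq p q" for f g
    using P that unfolding bounded_projection_onto_def by blast
  have cmult: "AE z in lebesgue. P (\<lambda>w. t * f w) z = t * P f z" if "f \<in> Lpq p q" for f t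
    using P that unfolding bounded_projection_onto_def by blast
  show diff: "AE z in lebesgue. P (\<lambda>w. f w - g w) z = P f z - P g z"
    if f: "f \<in> Lpq p q" and g: "g \<in> Lpq p q" for f g
    using add[OF f Lpq_cmult[OF p q g, of "-1"]] cmult[OF g, of "-1"]
    by eventually_elim simp
  show "AE z in lebesgue. P f z = f z" if f: "f \<in> Lpq p q" and "g \<in> U" and fg: "AE z in lebesgue. f z = g z"
  proof -
    obtain h where h: "h \<in> Lpq p q" and hg: "AE z in lebesgue. P h z = g z"
      using P \<open>g \<in> U\<close> unfolding bounded_projection_onto_def by blast
    have Ph: "P h \<in> Lpq p q" and PPh: "AE z in lebesgue. P (P h) z = P h z"
      using P h unfolding bounded_projection_onto_def by blast+
    obtain C :: real where C: "\<And>f. f \<in> Lpq p q \<Longrightarrow> Lpq_norm p q (P f) \<le> ennreal C * Lpq_norm p q f"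
      using P unfolding bounded_projection_onto_def by blast
    \<comment> \<open>Boundedness sends null functions to null functions, so \<open>P\<close> respects equality almost everywhere.\<close>
    define N where "N z = f z - P h z" for z
    have N: "N \<in> Lpq p q" unfolding N_def by (rule Lpq_diff[OF p q f Ph])
    have "AE z in lebesgue. N z = 0"
      using fg hg unfolding N_def by eventually_elim simp
    hence "Lpq_norm p q N = Lpq_norm p q (\<lambda>_ :: 'n point. 0)"
      by (rule Lpq_norm_cong_AE[OF p0 q0])
    also have "\<dots> = 0"
      using p0 q0 by (simp add: Lpq_norm_def)
    finally have "Lpq_norm p q (P N) = 0"
      using C[OF N] by simp
    moreover have "P N \<in> Lpq p q"
      using P N unfolding bounded_projection_onto_def by blast
    ultimately have "AE z in lebesgue. P N z = 0"
      by (intro Lpq_norm_eq_0D[OF p0 q0]) (auto simp: Lpq_def)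
    moreover have "AE z in lebesgue. P N z = P f z - P (P h) z"
      unfolding N_def by (rule diff[OF f Ph])
    ultimately show ?thesis using PPh fg hg
      by eventually_elim simp
  qed
qed

lemma bounded_projection_range:
  assumes "bounded_projection_onto p q U P" "f \<in> Lpq p q"
  obtains g where "g \<in> U" "AE z in lebesgue. P f z = g z"
  using assms unfolding bounded_projection_onto_def by blast

text \<open>The samples are integrals, so the operator sees functions only up to null sets. This makes the
  estimate for elements of the shift-invariant space available for the iteration errors, which
  are such elements only almost everywhere.\<close>

lemma avg_op_cong_AE:
  fixes \<psi> :: "'n::finite point \<Rightarrow> complex"
  assumes \<psi>: "continuous_on UNIV \<psi>"
    and f: "f \<in> borel_measurable lebesgue" and g: "g \<in> borel_measurable lebesgue"
    and fg: "AE z in lebesgue. f z = g z"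
  shows "avg_op \<psi> a J x y \<beta> f = avg_op \<psi> a J x y \<beta> g"
proof -
  have "avg_sample \<psi> a f w = avg_sample \<psi> a g w" for w
  proof -
    have "continuous_on UNIV (\<lambda>z. cnj (dilate a \<psi> (z - w)))"
      unfolding dilate_def by (intro continuous_intros continuous_on_compose2[OF \<psi>]) auto
    hence [measurable]: "(\<lambda>z. cnj (dilate a \<psi> (z - w))) \<in> borel_measurable lebesgue"
      by (intro measurable_completion) (simp add: borel_measurable_continuous_onI)
    note [measurable] = f g
    show ?thesis
      unfolding avg_sample_def pairing_def
      using fg by (intro integral_cong_AE) (auto elim!: eventually_mono)
  qed
  thus ?thesis by (simp add: avg_op_def fun_eq_iff)
qed

text \<open>If \<open>e\<close> agrees almost everywhere with an element of the range of \<open>P\<close>, then \<open>P e = e\<close>, and so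
  \<open>e - P A e = P (e - A e)\<close> is again in the range.\<close>

lemma projection_step_contracts:
  fixes A :: "('n::finite point \<Rightarrow> complex) \<Rightarrow> 'n point \<Rightarrow> complex"
  assumes p: "1 \<le> p" and q: "1 \<le> q" and P: "bounded_projection_onto p q U P"
    and C: "\<And>f. f \<in> Lpq p q \<Longrightarrow> Lpq_norm p q (P f) \<le> ennreal C * Lpq_norm p q f" and C0: "0 \<le> C"
    and A_meas: "\<And>f. A f \<in> borel_measurable lebesgue"
    and A_cong: "\<And>f g. f \<in> borel_measurable lebesgue \<Longrightarrow> g \<in> borel_measurable lebesgue \<Longrightarrow>
        AE z in lebesgue. f z = g z \<Longrightarrow> A f = A g"
    and U_meas: "\<And>g. g \<in> U \<Longrightarrow> g \<in> borel_measurable lebesgue"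
    and near: "\<And>g. g \<in> U \<Longrightarrow> Lpq_norm p q (\<lambda>z. g z - A g z) \<le> ennreal \<kappa> * Lpq_norm p q g"
    and e: "e \<in> Lpq p q" and eg: "g \<in> U" "AE z in lebesgue. e z = g z"
  shows "A e \<in> Lpq p q"
    and "\<exists>g'\<in>U. AE z in lebesgue. e z - P (A e) z = g' z"
    and "Lpq_norm p q (\<lambda>z. e z - P (A e) z) \<le> ennreal (C * \<kappa>) * Lpq_norm p q e"
proof -
  have p0: "0 < p" and q0: "0 < q" using p q by auto
  have em: "e \<in> borel_measurable lebesgue" and efin: "Lpq_norm p q e < \<infinity>"
    using e by (auto simp: Lpq_def)
  have Ae: "A e = A g" by (rule A_cong[OF em U_meas[OF eg(1)] eg(2)])
  define d where "d z = e z - A e z" for z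
  have dm: "d \<in> borel_measurable lebesgue"
    unfolding d_def using em A_meas[of e] by measurable
  have "Lpq_norm p q d = Lpq_norm p q (\<lambda>z. g z - A g z)"
    using eg(2) unfolding d_def Ae by (intro Lpq_norm_cong_AE p0 q0) (auto elim!: eventually_mono)
  also have "\<dots> \<le> ennreal \<kappa> * Lpq_norm p q g" by (rule near[OF eg(1)])
  also have "Lpq_norm p q g = Lpq_norm p q e"
    using eg(2) by (intro Lpq_norm_cong_AE p0 q0) (auto elim!: eventually_mono)
  finally have d_le: "Lpq_norm p q d \<le> ennreal \<kappa> * Lpq_norm p q e" .
  also have "\<dots> < \<infinity>" using efin by (simp add: ennreal_mult_less_top)
  finally have d: "d \<in> Lpq p q" using dm by (simp add: Lpq_def)
  have "(\<lambda>z. e z - d z) \<in> Lpq p q" by (rule Lpq_diff[OF p q e d])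
  thus AeL: "A e \<in> Lpq p q" by (simp add: d_def)
  have step: "AE z in lebesgue. e z - P (A e) z = P d z"
    using bounded_projection_diff[OF p q P e AeL] bounded_projection_fixes[OF p q P e eg]
    unfolding d_def by eventually_elim simp
  obtain g' where "g' \<in> U" "AE z in lebesgue. P d z = g' z"
    by (rule bounded_projection_range[OF P d])
  from this(1) show "\<exists>g'\<in>U. AE z in lebesgue. e z - P (A e) z = g' z"
  proof (rule rev_bexI)
    show "AE z in lebesgue. e z - P (A e) z = g' z"
      using step \<open>AE z in lebesgue. P d z = g' z\<close> by eventually_elim simp
  qed
  have "Lpq_norm p q (\<lambda>z. e z - P (A e) z) = Lpq_norm p q (P d)"
    by (rule Lpq_norm_cong_AE[OF p0 q0 step])
  also have "\<dots> \<le> ennreal C * Lpq_norm p q d" by (rule C[OF d])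
  also have "\<dots> \<le> ennreal C * (ennreal \<kappa> * Lpq_norm p q e)"
    by (intro mult_left_mono d_le) simp
  also have "\<dots> = ennreal (C * \<kappa>) * Lpq_norm p q e"
    using C0 by (simp add: ennreal_mult' mult.assoc)
  finally show "Lpq_norm p q (\<lambda>z. e z - P (A e) z) \<le> ennreal (C * \<kappa>) * Lpq_norm p q e" .
qed

theorem theorem3p3:
  fixes p q :: real
    and r :: nat
    and \<Phi> :: "nat \<Rightarrow> 'n::finite point \<Rightarrow> complex"
    and \<psi> :: "'n point \<Rightarrow> complex"
    and P :: "('n point \<Rightarrow> complex) \<Rightarrow> ('n point \<Rightarrow> complex)"
  assumes "1 \<le> p" and "1 \<le> q"
    and "\<forall>i\<in>{1..r}. \<Phi> i \<in> W0 1 1 \<and> compact (supp (\<Phi> i))"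
    and "bounded_projection_onto p q (V p q r \<Phi>) P"
    and "\<psi> \<in> W0 1 1" and "(LINT z|lebesgue. \<psi> z) = 1"
  shows "\<exists>\<gamma>0>0. \<exists>a0>0. \<forall>\<gamma>\<le>\<gamma>0. \<forall>a. 0 < a \<and> a \<le> a0 \<longrightarrow>
    (\<exists>\<alpha>::real. 0 \<le> \<alpha> \<and> \<alpha> < 1 \<and>
      (\<forall>(J :: 'j set) (x :: 'j \<Rightarrow> real) (y :: 'j \<Rightarrow> real ^ 'n) \<beta>.
         countable J \<and> dense_grid \<gamma> J x y \<and> bupu \<gamma> J x y \<beta> \<longrightarrow>
         (let A = avg_op \<psi> a J x y \<beta> in
          \<forall>f \<in> V p q r \<Phi>. \<forall>F :: nat \<Rightarrow> 'n point \<Rightarrow> complex.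
            F 1 = P (A f) \<and>
            (\<forall>n\<ge>1. F (n + 1) = (\<lambda>z. P (A (\<lambda>w. f w - F n w)) z + F n z)) \<longrightarrow>
            ((\<lambda>n. Lpq_norm p q (\<lambda>z. f z - F n z)) \<longlonglongrightarrow> 0) \<and>
            (\<exists>M::real. \<forall>n\<ge>1. Lpq_norm p q (\<lambda>z. f z - F n z) \<le> ennreal (M * \<alpha> ^ n)))))"
proof -
  note p = assms(1) and q = assms(2) and P = assms(4)
  have p0: "0 < p" and q0: "0 < q" using p q by auto
  define U where "U = V p q r \<Phi>"
  have compact: "compact (supp (\<Phi> i))" and cont: "continuous_on UNIV (\<Phi> i)" if "i \<in> {1..r}" for i
    using assms(3) that by (auto simp: W0_def)
  have \<psi>: "continuous_on UNIV \<psi>" using assms(5) by (simp add: W0_def)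
  have [measurable]: "\<psi> \<in> borel_measurable borel" by (rule borel_measurable_continuous_onI[OF \<psi>])
  have one: "(LINT u|lborel. \<psi> u) = 1"
    using assms(6) by (simp add: integral_completion)
  \<comment> \<open>A function that is not integrable has integral 0 by convention.\<close>
  hence int: "integrable lborel \<psi>"
    using not_integrable_integral_eq[of lborel \<psi>] by auto
  have U_cont: "continuous_on UNIV g" if "g \<in> U" for g
  proof -
    obtain c where "g = shift_comb r \<Phi> c" using \<open>g \<in> U\<close> unfolding U_def V_def by blast
    thus ?thesis using compact cont by (auto intro!: continuous_shift_comb)
  qed
  have U_meas: "g \<in> borel_measurable lebesgue" if "g \<in> U" for g
    using U_cont[OF that] by (intro measurable_completion) (simp add: borel_measurable_continuous_onI)
  \<comment> \<open>An element of the range agrees almost everywhere with a value of \<open>P\<close>.\<close>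
  have U_Lpq: "g \<in> Lpq p q" if g: "g \<in> U" for g
  proof -
    obtain h where h: "h \<in> Lpq p q" and hg: "AE z in lebesgue. P h z = g z"
      using P g unfolding bounded_projection_onto_def U_def by blast
    have "P h \<in> Lpq p q" using P h unfolding bounded_projection_onto_def by blast
    thus ?thesis
      using Lpq_norm_cong_AE[OF p0 q0 hg] U_meas[OF g] by (simp add: Lpq_def)
  qed
  obtain C0 :: real where C0: "\<And>f. f \<in> Lpq p q \<Longrightarrow> Lpq_norm p q (P f) \<le> ennreal C0 * Lpq_norm p q f"
    using P unfolding bounded_projection_onto_def by blast
  \<comment> \<open>\<open>C0\<close> may be 0 or negative, and \<open>C\<close> becomes a divisor.\<close>
  define C where "C = max 1 C0"
  have C: "Lpq_norm p q (P f) \<le> ennreal C * Lpq_norm p q f" if "f \<in> Lpq p q" for f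
    using C0[OF that] by (rule order_trans) (auto simp: C_def intro!: mult_right_mono ennreal_leI)
  have C1: "1 \<le> C" by (simp add: C_def)
  define \<kappa> where "\<kappa> = 1 / (2 * C)"
  have \<kappa>: "0 < \<kappa>" "C * \<kappa> = 1 / 2" using C1 by (auto simp: \<kappa>_def)
  obtain \<delta> where \<delta>: "0 < \<delta>"
    and near: "\<And>\<gamma> a J (x :: 'j \<Rightarrow> real) y \<beta> c. \<gamma> \<le> \<delta> \<Longrightarrow> 0 < a \<Longrightarrow> a \<le> \<delta> \<Longrightarrow> bupu \<gamma> J x y \<beta> \<Longrightarrow>
       Lpq_norm p q (\<lambda>z. shift_comb r \<Phi> c z - avg_op \<psi> a J x y \<beta> (shift_comb r \<Phi> c) z)
         \<le> ennreal \<kappa> * Lpq_norm p q (shift_comb r \<Phi> c)"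
    by (rule averaging_near_identity[where 'j = 'j and r = r and \<Phi> = \<Phi>, OF p q _ _ \<psi> int one \<kappa>(1)])
       (erule compact, erule cont, rule that)
  have convergence: "((\<lambda>n. Lpq_norm p q (\<lambda>z. f z - F n z)) \<longlonglongrightarrow> 0) \<and>
      (\<exists>M::real. \<forall>n\<ge>1. Lpq_norm p q (\<lambda>z. f z - F n z) \<le> ennreal (M * (1/2) ^ n))"
    if \<gamma>: "\<gamma> \<le> \<delta>" and a: "0 < a" "a \<le> \<delta>" and J: "countable J" and \<beta>: "bupu \<gamma> J x y \<beta>"
      and A: "A = avg_op \<psi> a J x y \<beta>" and f: "f \<in> U" and F1: "F 1 = P (A f)"
      and FS: "\<And>n. 1 \<le> n \<Longrightarrow> F (n + 1) = (\<lambda>z. P (A (\<lambda>w. f w - F n w)) z + F n z)"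
    for \<gamma> a J and x :: "'j \<Rightarrow> real" and y \<beta> A f F
  proof -
    have A_near: "Lpq_norm p q (\<lambda>z. g z - A g z) \<le> ennreal \<kappa> * Lpq_norm p q g" if "g \<in> U" for g
      using that near[OF \<gamma> a \<beta>] unfolding U_def V_def A by blast
    have A_meas: "A g \<in> borel_measurable lebesgue" for g
      unfolding A by (rule measurable_avg_op[OF J \<beta>])
    have A_cong: "A g = A h" if "g \<in> borel_measurable lebesgue" "h \<in> borel_measurable lebesgue"
        "AE z in lebesgue. g z = h z" for g h
      unfolding A by (rule avg_op_cong_AE[OF \<psi> that])
    have C': "0 \<le> C" using C1 by simp
    define E where "E n z = f z - F n z" for n z
    have PAL: "P g \<in> Lpq p q" if "g \<in> Lpq p q" for g
      using P that unfolding bounded_projection_onto_def by blast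
    have next_error: "E' \<in> Lpq p q \<and> (\<exists>g\<in>U. AE z in lebesgue. E' z = g z) \<and>
        Lpq_norm p q E' \<le> ennreal (1/2) * Lpq_norm p q e"
      if e: "e \<in> Lpq p q" and "\<exists>g\<in>U. AE z in lebesgue. e z = g z" and E': "E' = (\<lambda>z. e z - P (A e) z)"
      for e E'
    proof -
      from that(2) obtain g where g: "g \<in> U" "AE z in lebesgue. e z = g z" by blast
      have AeL: "A e \<in> Lpq p q"
        and inU: "\<exists>g'\<in>U. AE z in lebesgue. e z - P (A e) z = g' z"
        and le: "Lpq_norm p q (\<lambda>z. e z - P (A e) z) \<le> ennreal (C * \<kappa>) * Lpq_norm p q e"
        by (rule projection_step_contracts[where A = A and C = C and \<kappa> = \<kappa>,
              OF p q P[folded U_def] _ C' A_meas _ _ _ e g],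
            erule C, erule (2) A_cong, erule U_meas, erule A_near)+
      show ?thesis
        using Lpq_diff[OF p q e PAL[OF AeL]] inU le unfolding E' \<kappa>(2) by blast
    qed
    define M where "M = enn2real (Lpq_norm p q f)"
    have M: "Lpq_norm p q f = ennreal M"
      using U_Lpq[OF f] by (simp add: M_def Lpq_def)
    have "E n \<in> Lpq p q \<and> (\<exists>g\<in>U. AE z in lebesgue. E n z = g z) \<and>
        Lpq_norm p q (E n) \<le> ennreal (M * (1/2) ^ n)" if "1 \<le> n" for n
      using that
    proof (induction n rule: dec_induct)
      case base
      have "E 1 = (\<lambda>z. f z - P (A f) z)" unfolding E_def[abs_def] F1 ..
      moreover have "\<exists>g\<in>U. AE z in lebesgue. f z = g z" using f by auto
      ultimately have "E 1 \<in> Lpq p q \<and> (\<exists>g\<in>U. AE z in lebesgue. E 1 z = g z) \<and>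
          Lpq_norm p q (E 1) \<le> ennreal (1/2) * Lpq_norm p q f"
        by (intro next_error U_Lpq[OF f])
      moreover have "ennreal (1/2) * Lpq_norm p q f = ennreal (M * (1/2) ^ 1)"
        unfolding M by (subst ennreal_mult'[symmetric]) simp_all
      ultimately show ?case by (simp only:)
    next
      case (step n)
      have "E (Suc n) = (\<lambda>z. E n z - P (A (E n)) z)"
        using FS[OF step.hyps(1)] by (simp add: E_def[abs_def] fun_eq_iff)
      with step.IH have E': "E (Suc n) \<in> Lpq p q \<and> (\<exists>g\<in>U. AE z in lebesgue. E (Suc n) z = g z) \<and>
          Lpq_norm p q (E (Suc n)) \<le> ennreal (1/2) * Lpq_norm p q (E n)"
        by (intro next_error) auto
      have "ennreal (1/2) * Lpq_norm p q (E n) \<le> ennreal (1/2) * ennreal (M * (1/2) ^ n)"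
        using step.IH by (intro mult_left_mono) auto
      also have "\<dots> = ennreal (M * (1/2) ^ Suc n)"
        by (subst ennreal_mult'[symmetric]) simp_all
      finally show ?case using E' by auto
    qed
    hence bound: "Lpq_norm p q (\<lambda>z. f z - F n z) \<le> ennreal (M * (1/2) ^ n)" if "1 \<le> n" for n
      using that by (simp add: E_def[abs_def])
    have "(\<lambda>n. M * (1/2) ^ n) \<longlonglongrightarrow> M * 0"
      by (intro tendsto_intros LIMSEQ_realpow_zero) auto
    hence "(\<lambda>n. ennreal (M * (1/2) ^ n)) \<longlonglongrightarrow> ennreal 0"
      by (intro tendsto_ennrealI) simp
    hence lim: "(\<lambda>n. ennreal (M * (1/2) ^ n)) \<longlonglongrightarrow> 0" by simp
    have "(\<lambda>n. Lpq_norm p q (\<lambda>z. f z - F n z)) \<longlonglongrightarrow> 0"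
      by (rule tendsto_sandwich[OF _ _ tendsto_const lim])
         (auto intro!: always_eventually eventually_sequentiallyI[of 1] bound)
    with bound show ?thesis by blast
  qed
  show ?thesis
  proof (rule exI[of _ \<delta>], intro conjI \<delta>, rule exI[of _ \<delta>], intro conjI \<delta> allI impI,
      rule exI[of _ "1/2"], intro conjI allI impI)
    fix \<gamma> a and J :: "'j set" and x :: "'j \<Rightarrow> real" and y :: "'j \<Rightarrow> real ^ 'n" and \<beta>
    assume "\<gamma> \<le> \<delta>" "0 < a \<and> a \<le> \<delta>" "countable J \<and> dense_grid \<gamma> J x y \<and> bupu \<gamma> J x y \<beta>"
    thus "let A = avg_op \<psi> a J x y \<beta> in
          \<forall>f \<in> V p q r \<Phi>. \<forall>F :: nat \<Rightarrow> 'n point \<Rightarrow> complex.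
            F 1 = P (A f) \<and>
            (\<forall>n\<ge>1. F (n + 1) = (\<lambda>z. P (A (\<lambda>w. f w - F n w)) z + F n z)) \<longrightarrow>
            ((\<lambda>n. Lpq_norm p q (\<lambda>z. f z - F n z)) \<longlonglongrightarrow> 0) \<and>
            (\<exists>M::real. \<forall>n\<ge>1. Lpq_norm p q (\<lambda>z. f z - F n z) \<le> ennreal (M * (1/2) ^ n))"
      using convergence[OF _ _ _ _ _ refl] unfolding Let_def U_def by blast
  qed simp_all
qed

end
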